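(* Let $(\Omega,\mathcal{F},\mu)$ be a measure space, $p\in(1,+\infty)$, $k\ge 1$ an integer, and let $X$ be a Banach space with a uniformly convex and Gâteaux differentiable norm. Then $\mathscr{G}_{p,k}(X)$ is approximatively norm-compact in $L^p(\Omega,\mathcal{F},\mu,X)$.
   Context: A simple function is a function $\sum_{i=1}^n x_i\mathbf{1}_{A_i}$ with $n\ge 1$, $x_i\in X$, $A_i\in\mathcal{F}$. A function $f:\Omega\to X$ is strongly measurable if it is a pointwise limit of a sequence of simple functions. For $1\le p<\infty$, $L^p(X)=L^p(\Omega,\mathcal{F},\mu,X)$ is the Bochner space of strongly measurable $f:\Omega\to X$ with $\int_\Omega\|f\|^p\,d\mu<\infty$ (functions equal a.e. are identified), with norm $\|f\|_p=\left(\int_\Omega\|f\|^p\,d\mu\right)^{1/p}$. $\mathscr{G}_{p,k}(X)$ is the set of all functions $\sum_{i=1}^{l}x_i\mathbf{1}_{A_i}\in L^p(X)$ with $l\le k$, $\{A_i\}_{1\le i\le l}\subset\mathcal{F}$ a partition of $\Omega$, and $x_1,\dots,x_l\in X$. The norm of $X$ is Gâteaux differentiable if it is Gâteaux differentiable at every nonzero point of $X$. For a subset $K$ of a Banach space $Z$ and $z\in Z$, a minimizing sequence for $z$ is a sequence $(w_n)_n\subset K$ with $\|z-w_n\|\to d(z,K)=\inf_{w\in K}\|z-w\|$. $K$ is approximatively norm-compact if for every $z\in Z$, every minimizing sequence for $z$ admits a subnet that converges in norm to a point of $K$. Here $Z=L^p(X)$ and $K=\mathscr{G}_{p,k}(X)$.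 *)

theory Defs
  imports "HOL-Analysis.Analysis"
begin

section \<open>Geometry of the norm\<close>

definition uniformly_convex_norm :: "'b::real_normed_vector itself \<Rightarrow> bool" where
  "uniformly_convex_norm _ \<longleftrightarrow>
     (\<forall>\<epsilon>>0. \<exists>\<delta>>0. \<forall>x y :: 'b.
        norm x = 1 \<longrightarrow> norm y = 1 \<longrightarrow> norm (x - y) \<ge> \<epsilon> \<longrightarrow> norm ((1/2) *\<^sub>R (x + y)) \<le> 1 - \<delta>)"

definition gateaux_differentiable_at :: "('b::real_normed_vector \<Rightarrow> real) \<Rightarrow> 'b \<Rightarrow> bool" where
  "gateaux_differentiable_at F x \<longleftrightarrow>
     (\<exists>L. bounded_linear L \<and>
        (\<forall>h. ((\<lambda>t::real. (F (x + t *\<^sub>R h) - F x) / t) \<longlongrightarrow> L h) (at 0)))"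

definition gateaux_differentiable_norm :: "'b::real_normed_vector itself \<Rightarrow> bool" where
  "gateaux_differentiable_norm _ \<longleftrightarrow> (\<forall>x::'b. x \<noteq> 0 \<longrightarrow> gateaux_differentiable_at norm x)"


section \<open>Bochner spaces\<close>

text \<open>
  The Banach space is not assumed separable, so strong measurability is not the same as
  Borel measurability (nor is the range type in the class required by the library's
  Bochner integral).  Values of functions outside \<^term>\<open>space M\<close> are never inspected.
\<close>

definition strongly_measurable :: "'a measure \<Rightarrow> ('a \<Rightarrow> 'b::real_normed_vector) \<Rightarrow> bool" where
  "strongly_measurable M f \<longleftrightarrow>
     (\<exists>s. (\<forall>n. simple_function M (s n)) \<and> (\<forall>\<omega>\<in>space M. (\<lambda>n. s n \<omega>) \<longlonglongrightarrow> f \<omega>))"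

definition Lp_functions :: "'a measure \<Rightarrow> real \<Rightarrow> ('a \<Rightarrow> 'b::real_normed_vector) set" where
  "Lp_functions M p =
     {f. strongly_measurable M f \<and> (\<integral>\<^sup>+\<omega>. ennreal (norm (f \<omega>) powr p) \<partial>M) < \<infinity>}"

definition Lp_norm :: "'a measure \<Rightarrow> real \<Rightarrow> ('a \<Rightarrow> 'b::real_normed_vector) \<Rightarrow> real" where
  "Lp_norm M p f = enn2real (\<integral>\<^sup>+\<omega>. ennreal (norm (f \<omega>) powr p) \<partial>M) powr (1 / p)"

definition Lp_rel :: "'a measure \<Rightarrow> real \<Rightarrow> ('a \<Rightarrow> 'b::real_normed_vector) rel" where
  "Lp_rel M p = {(f, g). f \<in> Lp_functions M p \<and> g \<in> Lp_functions M p \<and> (AE \<omega> in M. f \<omega> = g \<omega>)}"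

definition Lp_space :: "'a measure \<Rightarrow> real \<Rightarrow> ('a \<Rightarrow> 'b::real_normed_vector) set set" where
  "Lp_space M p = Lp_functions M p // Lp_rel M p"

abbreviation Lp_class ::
    "'a measure \<Rightarrow> real \<Rightarrow> ('a \<Rightarrow> 'b::real_normed_vector) \<Rightarrow> ('a \<Rightarrow> 'b) set" where
  "Lp_class M p f \<equiv> Lp_rel M p `` {f}"

text \<open>
  The distance of two classes is the norm of the difference of representatives; it does not
  depend on the representatives, see \<open>Lp_dist_class\<close> below.
\<close>

definition Lp_dist ::
    "'a measure \<Rightarrow> real \<Rightarrow> ('a \<Rightarrow> 'b::real_normed_vector) set \<Rightarrow> ('a \<Rightarrow> 'b) set \<Rightarrow> real" where
  "Lp_dist M p u v = Lp_norm M p (\<lambda>\<omega>. (SOME f. f \<in> u) \<omega> - (SOME g. g \<in> v) \<omega>)"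

lemma equiv_Lp_rel:
  "equiv (Lp_functions M p :: ('a \<Rightarrow> 'b::real_normed_vector) set) (Lp_rel M p)"
  (is "equiv ?A ?R")
proof (rule equivI)
  show "?R \<subseteq> ?A \<times> ?A"
    by (auto simp: Lp_rel_def)
  show "refl_on ?A ?R"
    by (auto simp: refl_on_def Lp_rel_def)
  show "sym ?R"
    by (auto simp: sym_def Lp_rel_def eq_commute)
  show "trans ?R"
  proof (rule transI)
    fix f g h :: "'a \<Rightarrow> 'b"
    assume fg: "(f, g) \<in> ?R" and gh: "(g, h) \<in> ?R"
    from fg have "AE \<omega> in M. f \<omega> = g \<omega>" by (simp add: Lp_rel_def)
    moreover from gh have "AE \<omega> in M. g \<omega> = h \<omega>" by (simp add: Lp_rel_def)
    ultimately have "AE \<omega> in M. f \<omega> = h \<omega>" by eventually_elim simp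
    then show "(f, h) \<in> ?R" using fg gh by (simp add: Lp_rel_def)
  qed
qed

lemma Lp_class_in_Lp_space: "f \<in> Lp_functions M p \<Longrightarrow> Lp_class M p f \<in> Lp_space M p"
  by (simp add: Lp_space_def quotientI)

lemma Lp_norm_cong_AE:
  assumes "AE \<omega> in M. f \<omega> = g \<omega>"
  shows "Lp_norm M p f = Lp_norm M p g"
proof -
  have "(\<integral>\<^sup>+\<omega>. ennreal (norm (f \<omega>) powr p) \<partial>M) = (\<integral>\<^sup>+\<omega>. ennreal (norm (g \<omega>) powr p) \<partial>M)"
    using assms by (intro nn_integral_cong_AE) auto
  then show ?thesis by (simp add: Lp_norm_def)
qed

lemma Lp_dist_class:
  assumes "f \<in> Lp_functions M p" "g \<in> Lp_functions M p"
  shows "Lp_dist M p (Lp_class M p f) (Lp_class M p g) = Lp_norm M p (\<lambda>\<omega>. f \<omega> - g \<omega>)"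
proof -
  have ae: "AE \<omega> in M. h \<omega> = (SOME h'. h' \<in> Lp_class M p h) \<omega>" if "h \<in> Lp_functions M p"
    for h :: "'a \<Rightarrow> 'b"
  proof -
    have "h \<in> Lp_class M p h"
      using that by (simp add: Lp_rel_def)
    then have "(SOME h'. h' \<in> Lp_class M p h) \<in> Lp_class M p h"
      by (rule someI[where P = "\<lambda>h'. h' \<in> Lp_class M p h"])
    moreover have "AE \<omega> in M. h \<omega> = h' \<omega>" if "h' \<in> Lp_class M p h" for h'
      using that by (simp add: Lp_rel_def)
    ultimately show ?thesis by blast
  qed
  have "AE \<omega> in M. (SOME f'. f' \<in> Lp_class M p f) \<omega> - (SOME g'. g' \<in> Lp_class M p g) \<omega> = f \<omega> - g \<omega>"
    using ae[OF assms(1)] ae[OF assms(2)] by eventually_elim simp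
  then show ?thesis
    unfolding Lp_dist_def by (rule Lp_norm_cong_AE)
qed


section \<open>Functions with at most \<open>k\<close> values\<close>

text \<open>
  The indices run over \<open>0, \<dots>, l - 1\<close>, and parts of a partition may be empty.
\<close>

definition G_functions :: "'a measure \<Rightarrow> real \<Rightarrow> nat \<Rightarrow> ('a \<Rightarrow> 'b::real_normed_vector) set" where
  "G_functions M p k =
     {f \<in> Lp_functions M p. \<exists>l\<le>k. \<exists>(A :: nat \<Rightarrow> 'a set) (x :: nat \<Rightarrow> 'b).
        (\<forall>i<l. A i \<in> sets M) \<and> disjoint_family_on A {..<l} \<and> (\<Union>i<l. A i) = space M \<and>
        f = (\<lambda>\<omega>. \<Sum>i<l. indicator (A i) \<omega> *\<^sub>R x i)}"

definition G_set :: "'a measure \<Rightarrow> real \<Rightarrow> nat \<Rightarrow> ('a \<Rightarrow> 'b::real_normed_vector) set set" where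
  "G_set M p k = (\<lambda>f. Lp_class M p f) ` G_functions M p k"

lemma G_set_subset_Lp_space: "G_set M p k \<subseteq> Lp_space M p"
  by (auto simp: G_set_def G_functions_def intro: Lp_class_in_Lp_space)


section \<open>Approximative compactness\<close>

text \<open>
  A Banach space enters these definitions through its carrier \<open>Z\<close> and its distance
  \<open>d z w = \<parallel>z - w\<parallel>\<close> only.
\<close>

definition minimizing_sequence :: "('z \<Rightarrow> 'z \<Rightarrow> real) \<Rightarrow> 'z set \<Rightarrow> 'z \<Rightarrow> (nat \<Rightarrow> 'z) \<Rightarrow> bool" where
  "minimizing_sequence d K z w \<longleftrightarrow>
     (\<forall>n. w n \<in> K) \<and> (\<lambda>n. d z (w n)) \<longlonglongrightarrow> (INF v\<in>K. d z v)"

definition directed_set :: "'i set \<Rightarrow> ('i \<Rightarrow> 'i \<Rightarrow> bool) \<Rightarrow> bool" where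
  "directed_set D le \<longleftrightarrow>
     D \<noteq> {} \<and> (\<forall>i\<in>D. le i i) \<and>
     (\<forall>i\<in>D. \<forall>j\<in>D. \<forall>k\<in>D. le i j \<longrightarrow> le j k \<longrightarrow> le i k) \<and>
     (\<forall>i\<in>D. \<forall>j\<in>D. \<exists>k\<in>D. le i k \<and> le j k)"

definition subnet_index :: "'i set \<Rightarrow> ('i \<Rightarrow> 'i \<Rightarrow> bool) \<Rightarrow> ('i \<Rightarrow> nat) \<Rightarrow> bool" where
  "subnet_index D le \<phi> \<longleftrightarrow>
     directed_set D le \<and> (\<forall>N. \<exists>i0\<in>D. \<forall>i\<in>D. le i0 i \<longrightarrow> N \<le> \<phi> i)"

definition net_converges ::
    "('z \<Rightarrow> 'z \<Rightarrow> real) \<Rightarrow> 'i set \<Rightarrow> ('i \<Rightarrow> 'i \<Rightarrow> bool) \<Rightarrow> ('i \<Rightarrow> 'z) \<Rightarrow> 'z \<Rightarrow> bool" where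
  "net_converges d D le a y \<longleftrightarrow> (\<forall>e>0. \<exists>i0\<in>D. \<forall>i\<in>D. le i0 i \<longrightarrow> d (a i) y < e)"

text \<open>
  HOL cannot quantify over index types inside a formula, so the directed sets below are
  subsets of the type \<^typ>\<open>nat \<times> nat set\<close>.  This is no restriction: by \<open>subnet_index_universal\<close>
  a sequence with a convergent subnet over any index type has one over this type.
\<close>

definition has_convergent_subnet ::
    "('z \<Rightarrow> 'z \<Rightarrow> real) \<Rightarrow> (nat \<Rightarrow> 'z) \<Rightarrow> 'z \<Rightarrow> bool" where
  "has_convergent_subnet d w y \<longleftrightarrow>
     (\<exists>(D :: (nat \<times> nat set) set) le \<phi>. subnet_index D le \<phi> \<and> net_converges d D le (\<lambda>i. w (\<phi> i)) y)"

definition approximatively_norm_compact :: "'z set \<Rightarrow> ('z \<Rightarrow> 'z \<Rightarrow> real) \<Rightarrow> 'z set \<Rightarrow> bool" where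
  "approximatively_norm_compact Z d K \<longleftrightarrow>
     (\<forall>z\<in>Z. \<forall>w. minimizing_sequence d K z w \<longrightarrow> (\<exists>y\<in>K. has_convergent_subnet d w y))"

lemma subnet_index_universal:
  fixes D :: "'i set"
  assumes sub: "subnet_index D le \<phi>" and conv: "net_converges d D le (\<lambda>i. w (\<phi> i)) y"
  shows "has_convergent_subnet d w y"
proof -
  define T where "T i = \<phi> ` {j\<in>D. le i j}" for i
  define D' where "D' = {(n, S). n \<in> S \<and> (\<exists>i\<in>D. T i \<subseteq> S)}"
  define le' :: "nat \<times> nat set \<Rightarrow> nat \<times> nat set \<Rightarrow> bool" where "le' a b \<longleftrightarrow> snd b \<subseteq> snd a" for a b
  have dir: "directed_set D le" and tail: "\<And>N. \<exists>i0\<in>D. \<forall>i\<in>D. le i0 i \<longrightarrow> N \<le> \<phi> i"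
    using sub by (auto simp: subnet_index_def)
  have mem: "\<phi> i \<in> T i" if "i \<in> D" for i
    using that dir by (auto simp: T_def directed_set_def)
  have base: "(\<phi> i, T i) \<in> D'" if "i \<in> D" for i
    using that mem by (auto simp: D'_def)
  have up: "\<exists>c\<in>D'. le' a c \<and> le' b c" if ab: "a \<in> D'" "b \<in> D'" for a b
  proof -
    have D'_D: "\<exists>i\<in>D. T i \<subseteq> snd c" if "c \<in> D'" for c
      using that unfolding D'_def by (cases c) simp
    obtain i j where ij: "i \<in> D" "j \<in> D" "T i \<subseteq> snd a" "T j \<subseteq> snd b"
      using D'_D[OF ab(1)] D'_D[OF ab(2)] by blast
    obtain k where k: "k \<in> D" "le i k" "le j k"
      using dir ij unfolding directed_set_def by meson
    have "T k \<subseteq> T i \<inter> T j"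
      using dir ij k unfolding T_def directed_set_def by blast
    then have "le' a (\<phi> k, T k)" "le' b (\<phi> k, T k)"
      using ij by (auto simp: le'_def)
    then show ?thesis using base[OF k(1)] by blast
  qed
  have "D' \<noteq> {}"
    using base dir by (auto simp: directed_set_def)
  with up have dir': "directed_set D' le'"
    by (auto simp: directed_set_def le'_def)
  have transfer: "\<exists>c\<in>D'. \<forall>b\<in>D'. le' c b \<longrightarrow> P (fst b)"
    if "i0 \<in> D" "\<forall>i\<in>D. le i0 i \<longrightarrow> P (\<phi> i)" for P i0
  proof (intro bexI ballI impI)
    show "(\<phi> i0, T i0) \<in> D'" by (rule base) fact
    fix b assume "b \<in> D'" "le' (\<phi> i0, T i0) b"
    then have "fst b \<in> T i0" by (auto simp: D'_def le'_def)
    then show "P (fst b)" using that by (auto simp: T_def)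
  qed
  have "subnet_index D' le' fst"
    unfolding subnet_index_def
  proof (intro conjI allI)
    fix N
    obtain i0 where "i0 \<in> D" "\<forall>i\<in>D. le i0 i \<longrightarrow> N \<le> \<phi> i" using tail by blast
    then show "\<exists>c\<in>D'. \<forall>b\<in>D'. le' c b \<longrightarrow> N \<le> fst b" by (rule transfer)
  qed (rule dir')
  moreover have "net_converges d D' le' (\<lambda>b. w (fst b)) y"
    unfolding net_converges_def
  proof (intro allI impI)
    fix e :: real assume "e > 0"
    then obtain i0 where "i0 \<in> D" "\<forall>i\<in>D. le i0 i \<longrightarrow> d (w (\<phi> i)) y < e"
      using conv by (auto simp: net_converges_def)
    then show "\<exists>c\<in>D'. \<forall>b\<in>D'. le' c b \<longrightarrow> d (w (fst b)) y < e" by (rule transfer)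
  qed
  ultimately show ?thesis
    unfolding has_convergent_subnet_def by blast
qed

end

theory Submission
  imports Defs
begin

text \<open>
  Let \<open>g\<^sub>n\<close> be a minimizing sequence for \<open>f\<close>, where \<open>g\<^sub>n\<close> takes the values (centres)
  \<open>X n i\<close>, \<open>i < k\<close>, on the parts of a partition. The partitions need not converge in any sense, so
  the proof works with the centres and the pointwise distance of \<open>f\<close> to the nearest of them; a tuple
  of centres always costs at least the optimal value \<open>V\<close>, because a nearest-centre partition is
  available (\<open>nearest_function\<close>).

  As \<open>f\<close> has separable range, along a subsequence each centre either escapes to infinity or has a
  limiting distance \<open>r i \<omega>\<close> to every value \<open>f \<omega>\<close>. The minimum \<open>m\<close> of the \<open>r i\<close> has cost
  exactly \<open>V\<close>. This replaces weak compactness of the centres. Norm convergence comes from uniform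
  convexity: a centre that is asymptotically nearest on a set of positive measure converges, since
  otherwise midpoints of its distant members would beat the optimum
  (\<open>essential_centre_convergent\<close>).

  The limits of these centres form an optimal tuple. Differentiability of the norm makes the set of
  points with two different nearest limiting centres negligible (\<open>no_ties\<close>): points of a tie may be
  attributed to either centre, so the first-order condition for optimality must hold on every part of the
  tie set, although moving one of the centres towards the values of \<open>f\<close> there is a strict
  improvement to first order.

  Hence almost every point has only one limiting centre at distance \<open>m\<close>. Since \<open>\<parallel>f - g\<^sub>n\<parallel> \<longlonglongrightarrow> m\<close>
  almost everywhere along a further subsequence, \<open>g\<^sub>n\<close> must follow this centre whatever the partitions
  are, and dominated convergence gives convergence in \<open>L\<^sup>p\<close>
  (\<open>subsequence_converges\<close>). A measure that is infinite forces \<open>0\<close> to be one of the centres; this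
  provides the integrable bounds which constants provide for finite measures.
\<close>

section \<open>Powers and Bochner spaces\<close>

lemma powr_add_le:
  fixes a b p :: real
  assumes "0 \<le> a" "0 \<le> b" "0 \<le> p"
  shows "(a + b) powr p \<le> 2 powr p * (a powr p + b powr p)"
proof -
  have "(a + b) powr p \<le> (2 * max a b) powr p"
    using assms by (intro powr_mono2) auto
  also have "\<dots> = 2 powr p * max a b powr p"
    using assms by (simp add: powr_mult)
  also have "\<dots> \<le> 2 powr p * (a powr p + b powr p)"
    by (intro mult_left_mono) (auto simp: max_def)
  finally show ?thesis .
qed

text \<open>
  A Lipschitz bound for \<open>t \<mapsto> t\<^sup>p\<close> on \<open>[0, w]\<close>. It makes the difference quotients of
  \<open>\<parallel>u + t h\<parallel>\<^sup>p\<close> dominated, which allows differentiation under the integral sign.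
\<close>

lemma powr_diff_le:
  fixes a b w p :: real
  assumes "1 \<le> p" "0 \<le> a" "a \<le> w" "0 \<le> b" "b \<le> w"
  shows "\<bar>a powr p - b powr p\<bar> \<le> p * w powr (p - 1) * \<bar>a - b\<bar>"
proof -
  have *: "\<bar>a powr p - b powr p\<bar> \<le> p * w powr (p - 1) * \<bar>a - b\<bar>"
    if "0 \<le> b" "b < a" "a \<le> w" for a b
  proof -
    obtain z where z: "b < z" "z < a" "a powr p - b powr p = (a - b) * (p * z powr (p - 1))"
    proof (rule mvt[OF \<open>b < a\<close>, of "\<lambda>x. x powr p" "\<lambda>x y. y * (p * x powr (p - 1))"])
      show "continuous_on {b..a} (\<lambda>x. x powr p)"
        using \<open>0 \<le> b\<close> assms(1) by (intro continuous_on_powr') (auto intro!: continuous_intros)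
      show "((\<lambda>x. x powr p) has_derivative (\<lambda>y. y * (p * x powr (p - 1)))) (at x)" if "b < x" for x
        using that \<open>0 \<le> b\<close>
        by (auto intro!: derivative_eq_intros simp: powr_diff field_simps)
    qed blast
    have "z powr (p - 1) \<le> w powr (p - 1)"
      using z that assms(1) by (intro powr_mono2) auto
    then have "(a - b) * (p * z powr (p - 1)) \<le> (a - b) * (p * w powr (p - 1))"
      using that assms(1) by (intro mult_left_mono) auto
    moreover have "0 \<le> (a - b) * (p * z powr (p - 1))"
      using that assms(1) by auto
    ultimately show ?thesis
      using z that by (simp add: mult_ac)
  qed
  show ?thesis
    using *[of a b] *[of b a] assms
    by (cases a b rule: linorder_cases) (auto simp: abs_minus_commute)
qed

lemma strongly_measurable_diff:
  assumes "strongly_measurable M f" "strongly_measurable M g"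
  shows "strongly_measurable M (\<lambda>\<omega>. f \<omega> - g \<omega>)"
proof -
  obtain s t where s: "\<And>n. simple_function M (s n)" "\<And>\<omega>. \<omega> \<in> space M \<Longrightarrow> (\<lambda>n. s n \<omega>) \<longlonglongrightarrow> f \<omega>"
    and t: "\<And>n. simple_function M (t n)" "\<And>\<omega>. \<omega> \<in> space M \<Longrightarrow> (\<lambda>n. t n \<omega>) \<longlonglongrightarrow> g \<omega>"
    using assms unfolding strongly_measurable_def by metis
  show ?thesis
    unfolding strongly_measurable_def
    by (rule exI[of _ "\<lambda>n \<omega>. s n \<omega> - t n \<omega>"])
       (auto intro!: tendsto_diff s t simple_function_compose2[where h = "(-)"])
qed

lemma strongly_measurable_simple: "simple_function M f \<Longrightarrow> strongly_measurable M f"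
  unfolding strongly_measurable_def by (rule exI[of _ "\<lambda>_. f"]) auto

lemma borel_measurable_norm_strongly:
  assumes "strongly_measurable M f"
  shows "(\<lambda>\<omega>. norm (f \<omega>)) \<in> borel_measurable M"
proof -
  obtain s where s: "\<And>n. simple_function M (s n)" "\<And>\<omega>. \<omega> \<in> space M \<Longrightarrow> (\<lambda>n. s n \<omega>) \<longlonglongrightarrow> f \<omega>"
    using assms unfolding strongly_measurable_def by metis
  show ?thesis
  proof (rule borel_measurable_LIMSEQ_real)
    show "(\<lambda>n. norm (s n \<omega>)) \<longlonglongrightarrow> norm (f \<omega>)" if "\<omega> \<in> space M" for \<omega>
      using s(2)[OF that] by (rule tendsto_norm)
    show "(\<lambda>\<omega>. norm (s n \<omega>)) \<in> borel_measurable M" for n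
      by (rule borel_measurable_simple_function, rule simple_function_compose1[OF s(1)])
  qed
qed

text \<open>
  The range of a pointwise limit of simple functions is contained in the closure of the countable set of
  all their values. This is the only separability available, since the Banach space itself may be
  non-separable.
\<close>

lemma strongly_measurable_separable:
  assumes "strongly_measurable M f"
  obtains y :: "nat \<Rightarrow> 'b::real_normed_vector"
  where "\<forall>\<omega>\<in>space M. \<forall>e>0. \<exists>q. norm (f \<omega> - y q) < e"
proof -
  obtain s where s: "\<And>n. simple_function M (s n)" "\<And>\<omega>. \<omega> \<in> space M \<Longrightarrow> (\<lambda>n. s n \<omega>) \<longlonglongrightarrow> f \<omega>"
    using assms unfolding strongly_measurable_def by metis
  define S where "S = insert 0 (\<Union>n. s n ` space M)"
  have "countable S"
    using s(1) unfolding S_def simple_function_def by (auto intro: countable_finite)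
  moreover have "S \<noteq> {}" by (simp add: S_def)
  ultimately have range: "range (from_nat_into S) = S"
    by (rule range_from_nat_into[rotated])
  show thesis
  proof (rule that[of "from_nat_into S"], intro ballI allI impI)
    fix \<omega> and e :: real assume \<omega>: "\<omega> \<in> space M" and e: "0 < e"
    obtain n where "norm (s n \<omega> - f \<omega>) < e"
      using LIMSEQ_D[OF s(2)[OF \<omega>] e] by blast
    moreover have "s n \<omega> \<in> range (from_nat_into S)"
      unfolding range using \<omega> by (auto simp: S_def)
    ultimately show "\<exists>q. norm (f \<omega> - from_nat_into S q) < e"
      by (auto simp: norm_minus_commute)
  qed
qed

lemma Lp_functions_integrable:
  assumes "f \<in> Lp_functions M p"
  shows "integrable M (\<lambda>\<omega>. norm (f \<omega>) powr p)"
proof (rule integrableI_nonneg)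
  have [measurable]: "(\<lambda>\<omega>. norm (f \<omega>)) \<in> borel_measurable M"
    using assms by (intro borel_measurable_norm_strongly) (simp add: Lp_functions_def)
  show "(\<lambda>\<omega>. norm (f \<omega>) powr p) \<in> borel_measurable M" by measurable
qed (use assms in \<open>auto simp: Lp_functions_def\<close>)

lemma Lp_functionsI:
  assumes "strongly_measurable M f" "integrable M w" "\<And>\<omega>. \<omega> \<in> space M \<Longrightarrow> norm (f \<omega>) powr p \<le> w \<omega>"
  shows "f \<in> Lp_functions M p"
proof -
  have [measurable]: "(\<lambda>\<omega>. norm (f \<omega>)) \<in> borel_measurable M"
    by (intro borel_measurable_norm_strongly assms)
  have "integrable M (\<lambda>\<omega>. norm (f \<omega>) powr p)"
  proof (rule Bochner_Integration.integrable_bound[OF assms(2)])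
    show "AE \<omega> in M. norm (norm (f \<omega>) powr p) \<le> norm (w \<omega>)"
      using assms(3) by (intro AE_I2) force
  qed simp
  then show ?thesis
    using assms(1) unfolding Lp_functions_def integrable_iff_bounded by simp
qed

lemma Lp_functions_diff:
  assumes "f \<in> Lp_functions M p" "g \<in> Lp_functions M p" "0 \<le> p"
  shows "(\<lambda>\<omega>. f \<omega> - g \<omega>) \<in> Lp_functions M p"
proof (rule Lp_functionsI)
  show "strongly_measurable M (\<lambda>\<omega>. f \<omega> - g \<omega>)"
    using assms by (intro strongly_measurable_diff) (auto simp: Lp_functions_def)
  show "integrable M (\<lambda>\<omega>. 2 powr p * (norm (f \<omega>) powr p + norm (g \<omega>) powr p))"
    by (intro integrable_mult_right Bochner_Integration.integrable_add Lp_functions_integrable assms)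
  fix \<omega> assume "\<omega> \<in> space M"
  have "norm (f \<omega> - g \<omega>) powr p \<le> (norm (f \<omega>) + norm (g \<omega>)) powr p"
    using assms(3) by (intro powr_mono2 norm_triangle_ineq4) auto
  also have "\<dots> \<le> 2 powr p * (norm (f \<omega>) powr p + norm (g \<omega>) powr p)"
    using assms(3) by (intro powr_add_le) auto
  finally show "norm (f \<omega> - g \<omega>) powr p \<le> 2 powr p * (norm (f \<omega>) powr p + norm (g \<omega>) powr p)" .
qed

lemma Lp_norm_eq_integral:
  assumes "f \<in> Lp_functions M p"
  shows "Lp_norm M p f = (\<integral>\<omega>. norm (f \<omega>) powr p \<partial>M) powr (1 / p)"
proof -
  have "(\<integral>\<^sup>+\<omega>. ennreal (norm (f \<omega>) powr p) \<partial>M) = ennreal (\<integral>\<omega>. norm (f \<omega>) powr p \<partial>M)"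
    by (rule nn_integral_eq_integral[OF Lp_functions_integrable[OF assms]]) auto
  moreover have "0 \<le> (\<integral>\<omega>. norm (f \<omega>) powr p \<partial>M)"
    by (rule integral_nonneg_AE) auto
  ultimately show ?thesis
    by (simp add: Lp_norm_def)
qed

section \<open>Geometry of the norm along sequences\<close>

text \<open>
  Replacing vectors whose norms tend to \<open>r > 0\<close> by the vectors of norm \<open>r\<close> in the same
  directions changes nothing in the limit; this reduces the next lemma to the unit sphere.
\<close>

lemma tendsto_normalized:
  fixes a :: "nat \<Rightarrow> 'b::real_normed_vector"
  assumes a: "(\<lambda>n. norm (a n)) \<longlonglongrightarrow> r" and r: "0 < r"
  shows "(\<lambda>n. a n - r *\<^sub>R (a n /\<^sub>R norm (a n))) \<longlonglongrightarrow> 0"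
proof (rule tendsto_norm_zero_cancel, rule Lim_transform_eventually)
  show "(\<lambda>n. \<bar>norm (a n) - r\<bar>) \<longlonglongrightarrow> 0"
    using a by (simp add: LIM_zero_iff tendsto_rabs_zero_iff)
  show "\<forall>\<^sub>F n in sequentially. \<bar>norm (a n) - r\<bar> = norm (a n - r *\<^sub>R (a n /\<^sub>R norm (a n)))"
    using order_tendstoD(1)[OF a r]
  proof eventually_elim
    case (elim n)
    then have "a n - r *\<^sub>R (a n /\<^sub>R norm (a n)) = (norm (a n) - r) *\<^sub>R (a n /\<^sub>R norm (a n))"
      by (simp add: algebra_simps)
    also have "norm \<dots> = \<bar>norm (a n) - r\<bar>"
      unfolding norm_scaleR using elim by simp
    finally show ?case by simp
  qed
qed

text \<open>
  Sequential form of uniform convexity: if \<open>a\<^sub>n\<close>, \<open>b\<^sub>n\<close> and their midpoints all have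
  asymptotically the same norm, then \<open>a\<^sub>n\<close> and \<open>b\<^sub>n\<close> come together, because a gap on the unit
  sphere would cost the midpoint a fixed proportion of its norm.
\<close>

lemma uniformly_convex_norm_tendsto:
  fixes a b :: "nat \<Rightarrow> 'b::real_normed_vector"
  assumes uc: "uniformly_convex_norm TYPE('b)"
    and a: "(\<lambda>n. norm (a n)) \<longlonglongrightarrow> r" and b: "(\<lambda>n. norm (b n)) \<longlonglongrightarrow> r"
    and mid: "(\<lambda>n. norm ((1/2) *\<^sub>R (a n + b n))) \<longlonglongrightarrow> r"
  shows "(\<lambda>n. a n - b n) \<longlonglongrightarrow> 0"
proof (cases "r = 0")
  case True
  then show ?thesis
    using tendsto_diff[of a 0 sequentially b 0] a b by (simp add: tendsto_norm_zero_iff)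
next
  case False
  then have r: "0 < r"
    using LIMSEQ_le_const[OF a, of 0] by force
  define a' b' where "a' n = a n /\<^sub>R norm (a n)" and "b' n = b n /\<^sub>R norm (b n)" for n
  have pos: "\<forall>\<^sub>F n in sequentially. 0 < norm (a n) \<and> 0 < norm (b n)"
    using order_tendstoD(1)[OF a r] order_tendstoD(1)[OF b r] by eventually_elim simp
  have aa: "(\<lambda>n. a n - r *\<^sub>R a' n) \<longlonglongrightarrow> 0" and bb: "(\<lambda>n. b n - r *\<^sub>R b' n) \<longlonglongrightarrow> 0"
    unfolding a'_def b'_def by (rule tendsto_normalized[OF a r] tendsto_normalized[OF b r])+
  have "(\<lambda>n. norm ((1/2) *\<^sub>R (a n + b n)) -
      norm ((1/2) *\<^sub>R ((a n - r *\<^sub>R a' n) + (b n - r *\<^sub>R b' n)))) \<longlonglongrightarrow>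
      r - norm ((1/2) *\<^sub>R ((0::'b) + 0))"
    by (intro tendsto_diff mid tendsto_norm tendsto_scaleR tendsto_add aa bb tendsto_const)
  then have low: "(\<lambda>n. norm ((1/2) *\<^sub>R (a n + b n)) -
      norm ((1/2) *\<^sub>R ((a n - r *\<^sub>R a' n) + (b n - r *\<^sub>R b' n)))) \<longlonglongrightarrow> r"
    by simp
  have ab: "(\<lambda>n. a' n - b' n) \<longlonglongrightarrow> 0"
  proof (rule LIMSEQ_I)
    fix e :: real assume "0 < e"
    then obtain d where d: "0 < d"
      "\<And>x y::'b. norm x = 1 \<Longrightarrow> norm y = 1 \<Longrightarrow> e \<le> norm (x - y) \<Longrightarrow> norm ((1/2) *\<^sub>R (x + y)) \<le> 1 - d"
      using uc unfolding uniformly_convex_norm_def by metis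
    have "r * (1 - d) < r"
      using r d(1) by simp
    from order_tendstoD(1)[OF low this] pos
    have "\<forall>\<^sub>F n in sequentially. norm (a' n - b' n - 0) < e"
    proof eventually_elim
      case (elim n)
      let ?c = "(1/2) *\<^sub>R ((a n - r *\<^sub>R a' n) + (b n - r *\<^sub>R b' n))"
      have "(1/2) *\<^sub>R (a n + b n) - ?c = (1/2) *\<^sub>R (r *\<^sub>R a' n + r *\<^sub>R b' n)"
        by (simp add: algebra_simps)
      also have "\<dots> = r *\<^sub>R ((1/2) *\<^sub>R (a' n + b' n))"
        by (simp add: algebra_simps)
      finally have "norm ((1/2) *\<^sub>R (a n + b n)) - norm ?c \<le> r * norm ((1/2) *\<^sub>R (a' n + b' n))"
        using norm_triangle_ineq2[of "(1/2) *\<^sub>R (a n + b n)" ?c] r by simp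
      with elim have "r * (1 - d) < r * norm ((1/2) *\<^sub>R (a' n + b' n))"
        by linarith
      then have "1 - d < norm ((1/2) *\<^sub>R (a' n + b' n))"
        using r by (simp only: mult_less_cancel_left_pos)
      moreover have "norm (a' n) = 1" "norm (b' n) = 1"
        using elim by (simp_all add: a'_def b'_def)
      ultimately show ?case
        using d(2)[of "a' n" "b' n"] by fastforce
    qed
    then show "\<exists>no. \<forall>n\<ge>no. norm (a' n - b' n - 0) < e"
      by (simp add: eventually_sequentially)
  qed
  have "(\<lambda>n. (a n - r *\<^sub>R a' n) - (b n - r *\<^sub>R b' n) + r *\<^sub>R (a' n - b' n)) \<longlonglongrightarrow> 0 - 0 + r *\<^sub>R 0"
    by (intro tendsto_intros aa bb ab)
  moreover have "(a n - r *\<^sub>R a' n) - (b n - r *\<^sub>R b' n) + r *\<^sub>R (a' n - b' n) = a n - b n" for n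
    by (simp add: algebra_simps)
  ultimately show ?thesis
    by simp
qed

text \<open>
  The norm is not differentiable at the origin, but its power is, because \<open>p > 1\<close>; elsewhere this
  is the chain rule. Hence \<open>\<parallel>u + t h\<parallel>\<^sup>p\<close> has a derivative at \<open>t = 0\<close> for every \<open>u\<close>.
\<close>

lemma gateaux_norm_powr:
  fixes u h :: "'b::real_normed_vector"
  assumes gd: "gateaux_differentiable_norm TYPE('b)" and p: "1 < p"
  shows "\<exists>D. ((\<lambda>t. norm (u + t *\<^sub>R h) powr p) has_real_derivative D) (at 0)"
proof (cases "u = 0")
  case True
  have "(\<lambda>t. (norm (t *\<^sub>R h) powr p) / t) \<midarrow>0\<rightarrow> 0"
  proof (rule tendsto_norm_zero_cancel, rule Lim_transform_eventually)
    have "((\<lambda>t::real. \<bar>t\<bar> powr (p - 1)) \<longlongrightarrow> 0) (at 0)"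
      by (rule tendsto_zero_powrI[OF tendsto_rabs_zero[OF tendsto_ident_at] tendsto_const])
         (use p in auto)
    from tendsto_mult_left_zero[OF this, of "norm h powr p"]
    show "((\<lambda>t::real. \<bar>t\<bar> powr (p - 1) * norm h powr p) \<longlongrightarrow> 0) (at 0)" .
    show "\<forall>\<^sub>F t in at 0. \<bar>t\<bar> powr (p - 1) * norm h powr p = norm (norm (t *\<^sub>R h) powr p / t)"
      unfolding eventually_at
      by (rule exI[of _ 1]) (auto simp: powr_mult powr_diff)
  qed
  then show ?thesis
    using True p by (auto simp: DERIV_def intro!: exI[of _ 0])
next
  case False
  then obtain L where "((\<lambda>t::real. (norm (u + t *\<^sub>R h) - norm u) / t) \<longlongrightarrow> L h) (at 0)"
    using gd unfolding gateaux_differentiable_norm_def gateaux_differentiable_at_def by meson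
  then have L: "((\<lambda>t. norm (u + t *\<^sub>R h)) has_real_derivative L h) (at 0)"
    by (simp add: DERIV_def)
  have "((\<lambda>s. s powr p) has_real_derivative p * norm (u + 0 *\<^sub>R h) powr (p - 1)) (at (norm (u + 0 *\<^sub>R h)))"
    using False by (auto intro!: derivative_eq_intros)
  from DERIV_chain2[OF this L] show ?thesis by blast
qed

section \<open>Extraction of subsequences\<close>

text \<open>
  Diagonal extraction, obtained from Tychonoff's theorem: a product of countably many copies of
  \<open>[0, 1]\<close> is compact and metrizable, hence sequentially compact.
\<close>

lemma convergent_subsequence_countable:
  fixes a :: "nat \<Rightarrow> 'c::countable \<Rightarrow> real"
  assumes "\<And>n c. a n c \<in> {0..1}"
  obtains \<sigma> :: "nat \<Rightarrow> nat" and l where "strict_mono \<sigma>" "\<And>c. (\<lambda>n. a (\<sigma> n) c) \<longlonglongrightarrow> l c" "\<And>c. 0 \<le> l c"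
proof -
  have "compactin (product_topology (\<lambda>_::'c. euclidean :: real topology) UNIV) (PiE UNIV (\<lambda>_. {0..1}))"
    by (subst compactin_PiE) auto
  then have "compact (PiE UNIV (\<lambda>_::'c. {0..1::real}))"
    by (simp add: euclidean_product_topology)
  then have "seq_compact (PiE UNIV (\<lambda>_::'c. {0..1::real}))"
    by (simp add: compact_imp_seq_compact)
  moreover have "\<forall>n. a n \<in> PiE UNIV (\<lambda>_. {0..1})"
    using assms by auto
  ultimately obtain l \<sigma> where l: "l \<in> PiE UNIV (\<lambda>_. {0..1::real})" "strict_mono \<sigma>" "(a \<circ> \<sigma>) \<longlonglongrightarrow> l"
    by (rule seq_compactE)
  have "(\<lambda>n. a (\<sigma> n) c) \<longlonglongrightarrow> l c" for c
    using continuous_on_tendsto_compose[OF continuous_on_product_coordinates[of c] l(3)]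
    by (simp add: o_def)
  with l show thesis by (intro that[of \<sigma> l]) auto
qed

text \<open>
  Dominated functions whose pointwise upper limit is at most \<open>m\<close>, but whose integrals never fall
  below that of \<open>m\<close>, converge to \<open>m\<close> in \<open>L\<^sup>1\<close>: by dominated convergence the positive parts
  of \<open>u\<^sub>n - m\<close> have vanishing integrals, and the lower bound on the integrals makes the negative parts
  no larger. A subsequence then converges almost everywhere.
\<close>

lemma L1_convergence_of_minimizing:
  fixes u :: "nat \<Rightarrow> 'a \<Rightarrow> real" and m w :: "'a \<Rightarrow> real"
  assumes u: "\<And>n. u n \<in> borel_measurable M" and m: "integrable M m" and w: "integrable M w"
    and bound: "\<And>n \<omega>. \<omega> \<in> space M \<Longrightarrow> 0 \<le> u n \<omega> \<and> u n \<omega> \<le> w \<omega>"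
    and limsup: "\<And>\<omega> e. \<omega> \<in> space M \<Longrightarrow> 0 < e \<Longrightarrow> \<forall>\<^sub>F n in sequentially. u n \<omega> < m \<omega> + e"
    and low: "\<And>n. (\<integral>\<omega>. m \<omega> \<partial>M) \<le> (\<integral>\<omega>. u n \<omega> \<partial>M)"
  obtains \<sigma> :: "nat \<Rightarrow> nat" where "strict_mono \<sigma>" "AE \<omega> in M. (\<lambda>n. u (\<sigma> n) \<omega>) \<longlonglongrightarrow> m \<omega>"
proof -
  note [measurable] = u borel_measurable_integrable[OF m]
  have iu: "integrable M (u n)" for n
  proof (rule Bochner_Integration.integrable_bound[OF w u], rule AE_I2)
    show "norm (u n \<omega>) \<le> norm (w \<omega>)" if "\<omega> \<in> space M" for \<omega>
      using bound[OF that, of n] by simp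
  qed
  \<comment> \<open>With \<open>e\<close> the positive part of \<open>u - m\<close> one has \<open>\<bar>u - m\<bar> = 2 e - (u - m)\<close>.\<close>
  define e where "e n \<omega> = max (u n \<omega> - m \<omega>) 0" for n \<omega>
  have [measurable]: "e n \<in> borel_measurable M" for n
    unfolding e_def by measurable
  have ie: "integrable M (e n)" for n
    unfolding e_def by (intro integrable_max Bochner_Integration.integrable_diff iu m) simp
  have "(\<lambda>n. \<integral>\<omega>. e n \<omega> \<partial>M) \<longlonglongrightarrow> (\<integral>\<omega>. 0 \<partial>M)"
  proof (rule integral_dominated_convergence[where w = "\<lambda>\<omega>. w \<omega> + \<bar>m \<omega>\<bar>"])
    show "integrable M (\<lambda>\<omega>. w \<omega> + \<bar>m \<omega>\<bar>)"
      by (intro Bochner_Integration.integrable_add w integrable_abs m)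
    show "AE \<omega> in M. norm (e n \<omega>) \<le> w \<omega> + \<bar>m \<omega>\<bar>" for n
    proof (rule AE_I2)
      show "norm (e n \<omega>) \<le> w \<omega> + \<bar>m \<omega>\<bar>" if "\<omega> \<in> space M" for \<omega>
        using bound[OF that, of n] by (auto simp: e_def max_def abs_if)
    qed
    show "AE \<omega> in M. (\<lambda>n. e n \<omega>) \<longlonglongrightarrow> 0"
    proof (intro AE_I2 LIMSEQ_I)
      fix \<omega> and \<epsilon> :: real assume "\<omega> \<in> space M" "0 < \<epsilon>"
      then have "\<forall>\<^sub>F n in sequentially. u n \<omega> < m \<omega> + \<epsilon>" by (rule limsup)
      then have "\<forall>\<^sub>F n in sequentially. norm (e n \<omega> - 0) < \<epsilon>"
        by eventually_elim (use \<open>0 < \<epsilon>\<close> in \<open>auto simp: e_def\<close>)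
      then show "\<exists>no. \<forall>n\<ge>no. norm (e n \<omega> - 0) < \<epsilon>" by (simp add: eventually_sequentially)
    qed
  qed simp_all
  then have e0: "(\<lambda>n. 2 * (\<integral>\<omega>. e n \<omega> \<partial>M)) \<longlonglongrightarrow> 0"
    by (intro tendsto_mult_right_zero) simp
  have "(\<lambda>n. \<integral>\<omega>. norm (u n \<omega> - m \<omega>) \<partial>M) \<longlonglongrightarrow> 0"
  proof (rule tendsto_sandwich[OF _ _ tendsto_const e0])
    have "(\<integral>\<omega>. norm (u n \<omega> - m \<omega>) \<partial>M) \<le> 2 * (\<integral>\<omega>. e n \<omega> \<partial>M)" for n
    proof -
      have "(\<integral>\<omega>. norm (u n \<omega> - m \<omega>) \<partial>M) = (\<integral>\<omega>. 2 * e n \<omega> - (u n \<omega> - m \<omega>) \<partial>M)"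
        by (intro Bochner_Integration.integral_cong) (auto simp: e_def max_def abs_if)
      also have "\<dots> = 2 * (\<integral>\<omega>. e n \<omega> \<partial>M) - ((\<integral>\<omega>. u n \<omega> \<partial>M) - (\<integral>\<omega>. m \<omega> \<partial>M))"
        using iu m ie by simp
      finally show ?thesis using low[of n] by linarith
    qed
    then show "\<forall>\<^sub>F n in sequentially. (\<integral>\<omega>. norm (u n \<omega> - m \<omega>) \<partial>M) \<le> 2 * (\<integral>\<omega>. e n \<omega> \<partial>M)"
      by simp
  qed simp
  then obtain \<sigma> where "strict_mono \<sigma>" "AE \<omega> in M. (\<lambda>n. u (\<sigma> n) \<omega> - m \<omega>) \<longlonglongrightarrow> 0"
    using tendsto_L1_AE_subseq[of M "\<lambda>n \<omega>. u n \<omega> - m \<omega>"] iu m by auto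
  then show thesis
    by (intro that[of \<sigma>]) (auto simp: LIM_zero_iff)
qed

section \<open>Nearest centres\<close>

text \<open>
  In the application \<open>V\<close> is the \<open>p\<close>-th power of the distance from \<open>f\<close> to the functions with at
  most \<open>k\<close> values; it enters as a lower bound for their costs. Null spaces are excluded: over
  them every tuple of centres is optimal, and minimizing centres need not stay bounded.
\<close>

locale quantization =
  fixes M :: "'a measure" and p :: real and k :: nat and f :: "'a \<Rightarrow> 'b::banach" and V :: real
  assumes p: "1 < p" and f: "f \<in> Lp_functions M p"
    and nonnull: "emeasure M (space M) \<noteq> 0"
    and V_le: "\<And>g. g \<in> G_functions M p k \<Longrightarrow> V \<le> (\<integral>\<omega>. norm (f \<omega> - g \<omega>) powr p \<partial>M)"
begin

text \<open>
  A tuple of centres is indexed by a set of numbers below \<open>k\<close>. When the measure is infinite, a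
  \<open>p\<close>-integrable function with finitely many values vanishes on a set of infinite measure, so
  that \<open>0\<close> must be among its values; this value is always given the index \<open>0\<close>.
\<close>

definition admissible :: "nat set \<Rightarrow> (nat \<Rightarrow> 'b) \<Rightarrow> bool" where
  "admissible I x \<longleftrightarrow> I \<subseteq> {..<k} \<and> I \<noteq> {} \<and> (emeasure M (space M) = \<infinity> \<longrightarrow> 0 \<in> I \<and> x 0 = 0)"

definition near :: "nat set \<Rightarrow> (nat \<Rightarrow> 'b) \<Rightarrow> 'a \<Rightarrow> real" where
  "near I x \<omega> = Min ((\<lambda>i. norm (f \<omega> - x i)) ` I)"

text \<open>
  Constants are \<open>p\<close>-integrable over a finite measure only. Correspondingly the distance to the nearest
  admissible centre is at most \<open>\<parallel>f\<parallel>\<close> plus a constant if the measure is finite, and at most \<open>\<parallel>f\<parallel>\<close>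
  otherwise. Taking the summand \<open>1\<close> or \<open>0\<close> in the two cases yields one function \<open>W\<close> multiples
  of which dominate all integrands below.
\<close>

definition pad :: real where
  "pad = (if emeasure M (space M) = \<infinity> then 0 else 1)"

definition W :: "'a \<Rightarrow> real" where
  "W \<omega> = (norm (f \<omega>) + pad) powr p"

lemma space_nonempty: "space M \<noteq> {}"
  using nonnull by auto

lemma AE_exists: "AE \<omega> in M. P \<omega> \<Longrightarrow> \<exists>\<omega>\<in>space M. P \<omega>"
proof (rule ccontr)
  assume ae: "AE \<omega> in M. P \<omega>" and no: "\<not> (\<exists>\<omega>\<in>space M. P \<omega>)"
  from ae obtain N where N: "{\<omega> \<in> space M. \<not> P \<omega>} \<subseteq> N" "emeasure M N = 0" "N \<in> sets M"
    by (rule AE_E)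
  have "space M \<subseteq> N" using N(1) no by blast
  then have "emeasure M (space M) \<le> emeasure M N" by (rule emeasure_mono) fact
  with N(2) nonnull show False by simp
qed

lemma admissible_finite: "admissible I x \<Longrightarrow> finite I" "admissible I x \<Longrightarrow> I \<noteq> {}"
  by (auto simp: admissible_def intro: finite_subset)

lemma norm_diff_measurable [measurable]: "(\<lambda>\<omega>. norm (f \<omega> - c)) \<in> borel_measurable M"
proof (rule borel_measurable_norm_strongly, rule strongly_measurable_diff)
  show "strongly_measurable M f"
    using f by (simp add: Lp_functions_def)
  show "strongly_measurable M (\<lambda>_. c)"
    by (rule strongly_measurable_simple) simp
qed

lemma near_measurable [measurable]: "finite I \<Longrightarrow> near I x \<in> borel_measurable M"
  unfolding near_def[abs_def] by (rule borel_measurable_Min) auto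

lemma near_le: "finite I \<Longrightarrow> i \<in> I \<Longrightarrow> near I x \<omega> \<le> norm (f \<omega> - x i)"
  by (simp add: near_def)

lemma near_attained: "finite I \<Longrightarrow> I \<noteq> {} \<Longrightarrow> \<exists>i\<in>I. near I x \<omega> = norm (f \<omega> - x i)"
  using Min_in[of "(\<lambda>i. norm (f \<omega> - x i)) ` I"] unfolding near_def by fastforce

lemma near_nonneg: "finite I \<Longrightarrow> I \<noteq> {} \<Longrightarrow> 0 \<le> near I x \<omega>"
  using near_attained[of I x \<omega>] by auto

lemma pad_nonneg: "0 \<le> pad"
  by (simp add: pad_def)

lemma integrable_W: "integrable M W"
proof (rule Bochner_Integration.integrable_bound)
  have "integrable M (\<lambda>_. pad powr p)"
    using p by (auto simp: pad_def finite_measure.integrable_const finite_measureI)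
  then show "integrable M (\<lambda>\<omega>. 2 powr p * (norm (f \<omega>) powr p + pad powr p))"
    using Lp_functions_integrable[OF f]
    by (intro integrable_mult_right Bochner_Integration.integrable_add)
  have [measurable]: "(\<lambda>\<omega>. norm (f \<omega>)) \<in> borel_measurable M"
    using norm_diff_measurable[of 0] by simp
  show "W \<in> borel_measurable M"
    unfolding W_def[abs_def] by measurable
  show "AE \<omega> in M. norm (W \<omega>) \<le> norm (2 powr p * (norm (f \<omega>) powr p + pad powr p))"
  proof (rule AE_I2)
    fix \<omega>
    show "norm (W \<omega>) \<le> norm (2 powr p * (norm (f \<omega>) powr p + pad powr p))"
      using powr_add_le[of "norm (f \<omega>)" pad p] p pad_nonneg by (simp add: W_def)
  qed
qed

lemma powr_le_W:
  assumes "0 \<le> a" "0 \<le> C" "a \<le> C * (norm (f \<omega>) + pad)"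
  shows "a powr p \<le> C powr p * W \<omega>"
proof -
  have "a powr p \<le> (C * (norm (f \<omega>) + pad)) powr p"
    using assms p by (intro powr_mono2) auto
  also have "\<dots> = C powr p * W \<omega>"
    using assms pad_nonneg by (simp add: W_def powr_mult)
  finally show ?thesis .
qed

lemma integrable_near_W:
  assumes "u \<in> borel_measurable M" "\<And>\<omega>. \<omega> \<in> space M \<Longrightarrow> \<bar>u \<omega>\<bar> \<le> C * W \<omega>"
  shows "integrable M u"
proof (rule Bochner_Integration.integrable_bound)
  show "integrable M (\<lambda>\<omega>. C * W \<omega>)"
    by (intro integrable_mult_right integrable_W)
  show "AE \<omega> in M. norm (u \<omega>) \<le> norm (C * W \<omega>)"
    using assms(2) by (intro AE_I2) force
qed fact

lemma near_bound:
  assumes "finite I" "i \<in> I" "norm (x i) \<le> C" "emeasure M (space M) = \<infinity> \<Longrightarrow> x i = 0"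
  shows "near I x \<omega> \<le> (1 + C) * (norm (f \<omega>) + pad)"
proof -
  have C: "0 \<le> C" using assms(3) norm_ge_zero order_trans by blast
  have le: "near I x \<omega> \<le> norm (f \<omega>) + norm (x i)"
    using near_le[OF assms(1,2), of x \<omega>] norm_triangle_ineq4[of "f \<omega>" "x i"] by linarith
  have *: "0 \<le> C * norm (f \<omega>)" using C by simp
  show ?thesis
  proof (cases "emeasure M (space M) = \<infinity>")
    case True
    then have "near I x \<omega> \<le> norm (f \<omega>)" using le assms(4) by simp
    moreover have "(1 + C) * (norm (f \<omega>) + pad) = norm (f \<omega>) + C * norm (f \<omega>)"
      using True by (simp add: pad_def algebra_simps)
    ultimately show ?thesis using * by linarith
  next
    case False
    then have "(1 + C) * (norm (f \<omega>) + pad) = norm (f \<omega>) + C * norm (f \<omega>) + 1 + C"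
      by (simp add: pad_def algebra_simps)
    then show ?thesis using le assms(3) * by linarith
  qed
qed

lemma near_powr_bound:
  assumes "finite I" "i \<in> I" "norm (x i) \<le> C" "emeasure M (space M) = \<infinity> \<Longrightarrow> x i = 0"
  shows "near I x \<omega> powr p \<le> (1 + C) powr p * W \<omega>"
proof (rule powr_le_W)
  show "0 \<le> 1 + C"
    using assms(3) norm_ge_zero[of "x i"] by linarith
qed (use near_bound[of I i x C \<omega>] near_nonneg[of I x \<omega>] assms in auto)

lemma integrable_near_powr:
  assumes "admissible I x"
  shows "integrable M (\<lambda>\<omega>. near I x \<omega> powr p)"
proof -
  note fin = admissible_finite[OF assms]
  obtain i where i: "i \<in> I" "emeasure M (space M) = \<infinity> \<Longrightarrow> x i = 0"
    using assms by (cases "emeasure M (space M) = \<infinity>") (auto simp: admissible_def)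
  show ?thesis
  proof (rule integrable_near_W)
    show "(\<lambda>\<omega>. near I x \<omega> powr p) \<in> borel_measurable M"
      using fin by measurable
    show "\<bar>near I x \<omega> powr p\<bar> \<le> (1 + norm (x i)) powr p * W \<omega>" for \<omega>
      using near_powr_bound[OF fin(1) i(1) order_refl, of x \<omega>] i(2) by simp
  qed
qed

text \<open>
  Sending each point to its nearest centre, ties being broken in favour of the least index, produces a
  measurable partition. Hence costs of tuples of centres are costs of functions in the class, and
  arguments about partitions reduce to arguments about centres.
\<close>

lemma nearest_function:
  assumes "admissible I x"
  obtains g where "g \<in> G_functions M p k"
    "\<And>\<omega>. \<omega> \<in> space M \<Longrightarrow> \<exists>i\<in>I. g \<omega> = x i \<and> norm (f \<omega> - x i) = near I x \<omega>"
proof -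
  note fin = admissible_finite[OF assms]
  define sel where "sel \<omega> = (LEAST i. i \<in> I \<and> norm (f \<omega> - x i) = near I x \<omega>)" for \<omega>
  have sel: "sel \<omega> \<in> I" "norm (f \<omega> - x (sel \<omega>)) = near I x \<omega>" for \<omega>
  proof -
    have "\<exists>i. i \<in> I \<and> norm (f \<omega> - x i) = near I x \<omega>"
      using near_attained[OF fin, of x \<omega>] by metis
    from LeastI_ex[OF this] show "sel \<omega> \<in> I" "norm (f \<omega> - x (sel \<omega>)) = near I x \<omega>"
      by (auto simp: sel_def)
  qed
  have selk: "sel \<omega> < k" for \<omega>
    using sel(1)[of \<omega>] assms by (auto simp: admissible_def)
  note [measurable] = near_measurable[OF fin(1), of x]
  have sel_meas [measurable]: "sel \<in> measurable M (count_space UNIV)"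
    unfolding sel_def[abs_def] by measurable
  define A where "A i = {\<omega> \<in> space M. sel \<omega> = i}" for i
  have A: "A i \<in> sets M" for i
    unfolding A_def by measurable
  define g where "g = (\<lambda>\<omega>. \<Sum>i<k. indicator (A i) \<omega> *\<^sub>R x i)"
  have g: "g \<omega> = x (sel \<omega>)" if "\<omega> \<in> space M" for \<omega>
  proof -
    have "g \<omega> = (\<Sum>i<k. if i = sel \<omega> then x i else 0)"
      unfolding g_def using that by (intro sum.cong) (auto simp: A_def)
    then show ?thesis using selk[of \<omega>] by simp
  qed
  have "simple_function M sel"
    unfolding simple_function_def
  proof
    show "finite (sel ` space M)"
      by (rule finite_subset[of _ "{..<k}"]) (use selk in auto)
    show "\<forall>i\<in>sel ` space M. sel -` {i} \<inter> space M \<in> sets M"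
      using A by (auto simp: A_def vimage_def Int_def conj_commute)
  qed
  then have "simple_function M (\<lambda>\<omega>. x (sel \<omega>))"
    by (rule simple_function_compose1)
  then have sg: "simple_function M g"
    using simple_function_cong[of M g "\<lambda>\<omega>. x (sel \<omega>)"] g by simp
  have "g \<in> Lp_functions M p"
  proof (rule Lp_functionsI)
    show "strongly_measurable M g"
      by (rule strongly_measurable_simple) fact
    show "integrable M (\<lambda>\<omega>. 2 powr p * (norm (f \<omega>) powr p + near I x \<omega> powr p))"
      using Lp_functions_integrable[OF f] integrable_near_powr[OF assms]
      by (intro integrable_mult_right Bochner_Integration.integrable_add)
    fix \<omega> assume \<omega>: "\<omega> \<in> space M"
    have "norm (g \<omega>) \<le> norm (f \<omega>) + norm (f \<omega> - g \<omega>)"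
      by (metis add.commute norm_minus_commute norm_triangle_sub)
    then have "norm (g \<omega>) powr p \<le> (norm (f \<omega>) + near I x \<omega>) powr p"
      using g[OF \<omega>] sel(2) p by (intro powr_mono2) auto
    also have "\<dots> \<le> 2 powr p * (norm (f \<omega>) powr p + near I x \<omega> powr p)"
      using p near_nonneg[OF fin] by (intro powr_add_le) auto
    finally show "norm (g \<omega>) powr p \<le> 2 powr p * (norm (f \<omega>) powr p + near I x \<omega> powr p)" .
  qed
  then have "g \<in> G_functions M p k"
    unfolding G_functions_def
  proof (intro CollectI conjI exI[of _ k] exI[of _ A] exI[of _ x])
    show "disjoint_family_on A {..<k}" by (auto simp: disjoint_family_on_def A_def)
    show "(\<Union>i<k. A i) = space M" using selk by (auto simp: A_def)
    show "g = (\<lambda>\<omega>. \<Sum>i<k. indicator (A i) \<omega> *\<^sub>R x i)" by (rule g_def)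
  qed (use A in auto)
  then show thesis
    by (rule that) (use g sel in auto)
qed

lemma V_le_near:
  assumes "admissible I x"
  shows "V \<le> (\<integral>\<omega>. near I x \<omega> powr p \<partial>M)"
proof -
  obtain g where g: "g \<in> G_functions M p k"
    "\<And>\<omega>. \<omega> \<in> space M \<Longrightarrow> \<exists>i\<in>I. g \<omega> = x i \<and> norm (f \<omega> - x i) = near I x \<omega>"
    using nearest_function[OF assms] by blast
  have "(\<integral>\<omega>. norm (f \<omega> - g \<omega>) powr p \<partial>M) = (\<integral>\<omega>. near I x \<omega> powr p \<partial>M)"
    by (intro Bochner_Integration.integral_cong refl) (use g(2) in force)
  with V_le[OF g(1)] show ?thesis by simp
qed

section \<open>Optimal centres have negligible ties\<close>

text \<open>
  Move the centre \<open>x i\<close> of an optimal tuple to \<open>x i - t h\<close>, and let the points of \<open>S\<close>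
  follow it while all others keep a nearest centre different from \<open>x i\<close>. The cost changes by the
  integral over \<open>S\<close> alone and cannot drop for either sign of \<open>t\<close>, so the integral of the derivative
  over \<open>S\<close> vanishes. The freedom in the choice of \<open>S\<close> is what the lemma is for: points at which
  \<open>x i\<close> ties with another centre may be put into \<open>S\<close> or left out of it.
\<close>

lemma first_variation:
  fixes x :: "nat \<Rightarrow> 'b" and h :: 'b
  assumes adm: "admissible K x" and opt: "(\<integral>\<omega>. near K x \<omega> powr p \<partial>M) \<le> V"
    and i: "i \<in> K" "x i \<noteq> 0" and S: "S \<in> sets M"
    and on: "\<And>\<omega>. \<omega> \<in> S \<Longrightarrow> norm (f \<omega> - x i) = near K x \<omega>"
    and off: "\<And>\<omega>. \<omega> \<in> space M - S \<Longrightarrow> \<exists>j\<in>K - {i}. norm (f \<omega> - x j) = near K x \<omega>"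
    and D: "\<And>\<omega>. \<omega> \<in> space M \<Longrightarrow> ((\<lambda>t. norm ((f \<omega> - x i) + t *\<^sub>R h) powr p) has_real_derivative D \<omega>) (at 0)"
  shows "integrable M (\<lambda>\<omega>. indicator S \<omega> * D \<omega>)" "(\<integral>\<omega>. indicator S \<omega> * D \<omega> \<partial>M) = 0"
proof -
  note fin = admissible_finite[OF adm]
  \<comment> \<open>Over an infinite measure the constants \<open>\<parallel>x i\<parallel>\<close> and \<open>\<parallel>h\<parallel>\<close> have to be bounded by a multiple of
    \<open>\<parallel>f\<parallel>\<close> on \<open>S\<close>. There \<open>x i\<close> is at least as near to \<open>f\<close> as the centre \<open>0\<close>, which gives
    \<open>\<parallel>x i\<parallel> \<le> 2 \<parallel>f\<parallel>\<close>, and \<open>\<parallel>h\<parallel>\<close> is a multiple of \<open>\<parallel>x i\<parallel>\<close> because \<open>x i \<noteq> 0\<close>.\<close>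
  obtain C where C: "0 \<le> C" "\<And>\<omega>. \<omega> \<in> S \<Longrightarrow> norm (f \<omega> - x i) + norm h \<le> C * (norm (f \<omega>) + pad)"
  proof (cases "emeasure M (space M) = \<infinity>")
    case True
    have "norm (f \<omega> - x i) + norm h \<le> (1 + 2 * (norm h / norm (x i))) * (norm (f \<omega>) + pad)" if "\<omega> \<in> S" for \<omega>
    proof -
      have "near K x \<omega> \<le> norm (f \<omega>)"
        using near_le[OF fin(1), of 0 x \<omega>] adm True by (auto simp: admissible_def)
      with on[OF that] have *: "norm (f \<omega> - x i) \<le> norm (f \<omega>)" by simp
      then have "norm (x i) \<le> 2 * norm (f \<omega>)"
        using norm_triangle_sub[of "x i" "f \<omega>"] by (simp add: norm_minus_commute)
      then have "(norm h / norm (x i)) * norm (x i) \<le> (norm h / norm (x i)) * (2 * norm (f \<omega>))"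
        by (intro mult_left_mono) auto
      with * i(2) True show ?thesis by (simp add: pad_def algebra_simps)
    qed
    then show thesis by (intro that[of "1 + 2 * (norm h / norm (x i))"]) auto
  next
    case False
    have "norm (f \<omega> - x i) + norm h \<le> (1 + norm (x i) + norm h) * (norm (f \<omega>) + pad)" for \<omega>
    proof -
      have "0 \<le> (norm (x i) + norm h) * norm (f \<omega>)" by simp
      moreover have "norm (f \<omega> - x i) \<le> norm (f \<omega>) + norm (x i)" by (rule norm_triangle_ineq4)
      moreover have "(1 + norm (x i) + norm h) * (norm (f \<omega>) + pad) =
          norm (f \<omega>) + (norm (x i) + norm h) * norm (f \<omega>) + 1 + norm (x i) + norm h"
        using False by (simp add: pad_def algebra_simps)
      ultimately show ?thesis by linarith
    qed
    then show thesis by (intro that[of "1 + norm (x i) + norm h"]) auto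
  qed
  define B where "B = p * C powr p"
  define Q where "Q t \<omega> = indicator S \<omega> * ((norm ((f \<omega> - x i) + t *\<^sub>R h) powr p - norm (f \<omega> - x i) powr p) / t)" for t \<omega>
  have Qm: "Q t \<in> borel_measurable M" for t
  proof -
    have [measurable]: "(\<lambda>\<omega>. norm ((f \<omega> - x i) + t *\<^sub>R h)) \<in> borel_measurable M"
      using norm_diff_measurable[of "x i - t *\<^sub>R h"] by (simp add: algebra_simps)
    show ?thesis unfolding Q_def[abs_def] using S by measurable
  qed
  have Qb: "\<bar>Q t \<omega>\<bar> \<le> B * W \<omega>" if t: "t \<noteq> 0" "\<bar>t\<bar> \<le> 1" for t \<omega>
  proof (cases "\<omega> \<in> S")
    case True
    define w where "w = norm (f \<omega> - x i) + norm h"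
    have w: "0 \<le> w" "norm h \<le> w" by (auto simp: w_def)
    have ht: "norm (t *\<^sub>R h) \<le> norm h"
      using t(2) by (simp add: mult_left_le_one_le)
    have le: "norm ((f \<omega> - x i) + t *\<^sub>R h) \<le> w"
      unfolding w_def using norm_triangle_ineq[of "f \<omega> - x i" "t *\<^sub>R h"] ht by linarith
    have diff: "\<bar>norm ((f \<omega> - x i) + t *\<^sub>R h) - norm (f \<omega> - x i)\<bar> \<le> \<bar>t\<bar> * norm h"
      using norm_triangle_ineq3[of "(f \<omega> - x i) + t *\<^sub>R h" "f \<omega> - x i"] by simp
    have "\<bar>norm ((f \<omega> - x i) + t *\<^sub>R h) powr p - norm (f \<omega> - x i) powr p\<bar>
        \<le> p * w powr (p - 1) * \<bar>norm ((f \<omega> - x i) + t *\<^sub>R h) - norm (f \<omega> - x i)\<bar>"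
      using p le by (intro powr_diff_le) (auto simp: w_def)
    also have "\<dots> \<le> p * w powr (p - 1) * (\<bar>t\<bar> * norm h)"
      using p diff by (intro mult_left_mono) auto
    also have "\<dots> \<le> p * w powr (p - 1) * (\<bar>t\<bar> * w)"
      using p w by (intro mult_left_mono) auto
    also have "\<dots> = \<bar>t\<bar> * (p * w powr p)"
      using w by (cases "w = 0") (auto simp: powr_diff)
    finally have "\<bar>Q t \<omega>\<bar> \<le> p * w powr p"
      using t True by (simp add: Q_def divide_le_eq mult.commute)
    also have "\<dots> \<le> p * (C powr p * W \<omega>)"
      using powr_le_W[OF w(1) C(1), of \<omega>] C(2)[OF True] p unfolding w_def
      by (intro mult_left_mono) auto
    finally show ?thesis by (simp add: B_def)
  next
    case False
    then show ?thesis using p by (simp add: Q_def B_def W_def)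
  qed
  have Qi: "integrable M (Q t)" if "t \<noteq> 0" "\<bar>t\<bar> \<le> 1" for t
    by (rule integrable_near_W[OF Qm Qb[OF that]])
  have Q_nonneg: "0 \<le> t * (\<integral>\<omega>. Q t \<omega> \<partial>M)" if t: "t \<noteq> 0" "\<bar>t\<bar> \<le> 1" for t
  proof -
    define x' where "x' = x(i := x i - t *\<^sub>R h)"
    have adm': "admissible K x'"
      using adm i by (auto simp: admissible_def x'_def)
    have "V \<le> (\<integral>\<omega>. near K x' \<omega> powr p \<partial>M)"
      by (rule V_le_near[OF adm'])
    also have "\<dots> \<le> (\<integral>\<omega>. near K x \<omega> powr p + t * Q t \<omega> \<partial>M)"
    proof (rule integral_mono)
      show "integrable M (\<lambda>\<omega>. near K x \<omega> powr p + t * Q t \<omega>)"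
        using integrable_near_powr[OF adm] Qi[OF t]
        by (intro Bochner_Integration.integrable_add integrable_mult_right)
      fix \<omega> assume \<omega>: "\<omega> \<in> space M"
      show "near K x' \<omega> powr p \<le> near K x \<omega> powr p + t * Q t \<omega>"
      proof (cases "\<omega> \<in> S")
        case True
        have "near K x' \<omega> \<le> norm ((f \<omega> - x i) + t *\<^sub>R h)"
          using near_le[OF fin(1) i(1), of x' \<omega>] by (simp add: x'_def algebra_simps)
        then have "near K x' \<omega> powr p \<le> norm ((f \<omega> - x i) + t *\<^sub>R h) powr p"
          using near_nonneg[OF fin] p by (intro powr_mono2) auto
        then show ?thesis
          using on[OF True] True t by (simp add: Q_def)
      next
        case False
        then obtain j where j: "j \<in> K" "j \<noteq> i" "norm (f \<omega> - x j) = near K x \<omega>"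
          using off[of \<omega>] \<omega> by auto
        have "near K x' \<omega> \<le> near K x \<omega>"
          using near_le[OF fin(1) j(1), of x' \<omega>] j by (simp add: x'_def)
        then have "near K x' \<omega> powr p \<le> near K x \<omega> powr p"
          using near_nonneg[OF fin] p by (intro powr_mono2) auto
        then show ?thesis using False by (simp add: Q_def)
      qed
    qed (rule integrable_near_powr[OF adm'])
    also have "\<dots> = (\<integral>\<omega>. near K x \<omega> powr p \<partial>M) + t * (\<integral>\<omega>. Q t \<omega> \<partial>M)"
      using integrable_near_powr[OF adm] Qi[OF t] by simp
    finally show ?thesis using opt by linarith
  qed
  have Q_lim: "(\<lambda>n. Q (s n) \<omega>) \<longlonglongrightarrow> indicator S \<omega> * D \<omega>"
    if \<omega>: "\<omega> \<in> space M" and s: "filterlim s (at 0) sequentially" for \<omega> s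
  proof -
    have "((\<lambda>t. (norm ((f \<omega> - x i) + t *\<^sub>R h) powr p - norm (f \<omega> - x i) powr p) / t) \<longlongrightarrow> D \<omega>) (at 0)"
      using D[OF \<omega>] by (simp add: DERIV_def)
    from filterlim_compose[OF this s] show ?thesis
      unfolding Q_def by (rule tendsto_mult_left)
  qed
  have s: "filterlim (\<lambda>n. c / real (Suc n)) (at 0) sequentially" if "c \<noteq> 0" for c :: real
    using that LIMSEQ_Suc[OF lim_const_over_n[of c]] by (auto simp: filterlim_at)
  \<comment> \<open>The cases \<open>c = 1\<close> and \<open>c = -1\<close> give the two one-sided inequalities.\<close>
  define q where "q c n = Q (c / real (Suc n))" for c n
  have small: "c / real (Suc n) \<noteq> 0 \<and> \<bar>c / real (Suc n)\<bar> \<le> 1" if "\<bar>c\<bar> = 1" for c n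
    using that by auto
  have Dm: "(\<lambda>\<omega>. indicator S \<omega> * D \<omega>) \<in> borel_measurable M"
  proof (rule borel_measurable_LIMSEQ_real)
    show "(\<lambda>n. Q (1 / real (Suc n)) \<omega>) \<longlonglongrightarrow> indicator S \<omega> * D \<omega>" if "\<omega> \<in> space M" for \<omega>
      by (rule Q_lim[OF that s]) simp
  qed (rule Qm)
  have dct: "integrable M (\<lambda>\<omega>. indicator S \<omega> * D \<omega>)"
    "(\<lambda>n. \<integral>\<omega>. q c n \<omega> \<partial>M) \<longlonglongrightarrow> (\<integral>\<omega>. indicator S \<omega> * D \<omega> \<partial>M)" if c: "\<bar>c\<bar> = 1" for c
  proof -
    have c0: "c \<noteq> 0" using c by auto
    have 1: "q c n \<in> borel_measurable M" for n
      unfolding q_def by (rule Qm)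
    have 2: "AE \<omega> in M. (\<lambda>n. q c n \<omega>) \<longlonglongrightarrow> indicator S \<omega> * D \<omega>"
      unfolding q_def by (rule AE_I2, rule Q_lim) (use s[OF c0] in auto)
    have 3: "AE \<omega> in M. norm (q c n \<omega>) \<le> B * W \<omega>" for n
      unfolding q_def real_norm_def by (rule AE_I2, rule Qb) (use small[OF c] in auto)
    have 4: "integrable M (\<lambda>\<omega>. B * W \<omega>)"
      by (intro integrable_mult_right integrable_W)
    show "integrable M (\<lambda>\<omega>. indicator S \<omega> * D \<omega>)"
      by (rule integrable_dominated_convergence[OF Dm 1 4 2 3])
    show "(\<lambda>n. \<integral>\<omega>. q c n \<omega> \<partial>M) \<longlonglongrightarrow> (\<integral>\<omega>. indicator S \<omega> * D \<omega> \<partial>M)"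
      by (rule integral_dominated_convergence[OF Dm 1 4 2 3])
  qed
  show "integrable M (\<lambda>\<omega>. indicator S \<omega> * D \<omega>)"
    by (rule dct(1)[of 1]) simp
  have "0 \<le> (\<integral>\<omega>. q 1 n \<omega> \<partial>M)" for n
  proof -
    have "0 < 1 / real (Suc n)" by simp
    then show ?thesis
      using Q_nonneg[of "1 / real (Suc n)"] small[of 1 n] zero_le_mult_iff
      unfolding q_def by (metis abs_one not_less)
  qed
  then have "0 \<le> (\<integral>\<omega>. indicator S \<omega> * D \<omega> \<partial>M)"
    using dct(2)[of 1] by (intro LIMSEQ_le_const) auto
  moreover have "(\<integral>\<omega>. q (-1) n \<omega> \<partial>M) \<le> 0" for n
  proof -
    have "(-1) / real (Suc n) < 0" by simp
    then show ?thesis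
      using Q_nonneg[of "(-1) / real (Suc n)"] small[of "-1" n] zero_le_mult_iff
      unfolding q_def by (metis abs_minus abs_one not_less)
  qed
  then have "(\<integral>\<omega>. indicator S \<omega> * D \<omega> \<partial>M) \<le> 0"
    using dct(2)[of "-1"] by (intro LIMSEQ_le_const2) auto
  ultimately show "(\<integral>\<omega>. indicator S \<omega> * D \<omega> \<partial>M) = 0" by simp
qed

text \<open>
  Let \<open>T\<close> be the set of ties between \<open>x i\<close> and \<open>x j\<close> at which \<open>f\<close> is close to a fixed point
  \<open>y\<close> and far from \<open>x i\<close>. Everything nearest to \<open>x i\<close> may follow the motion of this centre,
  but the points of \<open>T\<close> may as well stay with \<open>x j\<close>; both choices make the first variation vanish,
  so its part over \<open>T\<close> vanishes; this uses two-sided differentiability of the norm. Moving \<open>x i\<close> towards \<open>y\<close>, however, decreases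
  \<open>\<parallel>f - x i\<parallel>\<close> at a positive rate on \<open>T\<close>. Hence \<open>T\<close> is a null set.
\<close>

lemma no_ties_near_point:
  fixes x :: "nat \<Rightarrow> 'b" and y :: 'b
  assumes gd: "gateaux_differentiable_norm TYPE('b)"
    and adm: "admissible K x" and opt: "(\<integral>\<omega>. near K x \<omega> powr p \<partial>M) \<le> V"
    and i: "i \<in> K" "x i \<noteq> 0" and j: "j \<in> K" "j \<noteq> i" and \<rho>: "0 < \<rho>"
  shows "AE \<omega> in M. \<not> (norm (f \<omega> - x i) = near K x \<omega> \<and> norm (f \<omega> - x j) = near K x \<omega> \<and>
    2 * \<rho> < norm (f \<omega> - x i) \<and> norm (f \<omega> - y) < \<rho>)"
proof -
  note fin = admissible_finite[OF adm]
  note [measurable] = near_measurable[OF fin(1), of x]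
  define E where "E = {\<omega> \<in> space M. norm (f \<omega> - x i) = near K x \<omega>}"
  define T where "T = {\<omega> \<in> space M. norm (f \<omega> - x i) = near K x \<omega> \<and> norm (f \<omega> - x j) = near K x \<omega> \<and>
    2 * \<rho> < norm (f \<omega> - x i) \<and> norm (f \<omega> - y) < \<rho>}"
  have E: "E \<in> sets M" unfolding E_def by measurable
  have T: "T \<in> sets M" unfolding T_def by measurable
  define h where "h = x i - y"
  have "\<forall>\<omega>. \<exists>d. ((\<lambda>t. norm ((f \<omega> - x i) + t *\<^sub>R h) powr p) has_real_derivative d) (at 0)"
    by (rule allI, rule gateaux_norm_powr[OF gd p])
  from choice[OF this] obtain D
    where D: "\<And>\<omega>. ((\<lambda>t. norm ((f \<omega> - x i) + t *\<^sub>R h) powr p) has_real_derivative D \<omega>) (at 0)"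
    by blast
  have other: "\<exists>l\<in>K - {i}. norm (f \<omega> - x l) = near K x \<omega>" if "\<omega> \<in> space M - E" for \<omega>
  proof -
    obtain l where "l \<in> K" "near K x \<omega> = norm (f \<omega> - x l)"
      using near_attained[OF fin] by blast
    with that show ?thesis by (intro bexI[of _ l]) (auto simp: E_def)
  qed
  note EE = first_variation[OF adm opt i E _ other D]
  have other': "\<exists>l\<in>K - {i}. norm (f \<omega> - x l) = near K x \<omega>" if "\<omega> \<in> space M - (E - T)" for \<omega>
  proof (cases "\<omega> \<in> T")
    case True
    then show ?thesis using j by (intro bexI[of _ j]) (auto simp: T_def)
  qed (use that other in blast)
  have ET: "E - T \<in> sets M" using E T by blast
  note ETT = first_variation[OF adm opt i ET _ other' D]
  have E1: "integrable M (\<lambda>\<omega>. indicator E \<omega> * D \<omega>)" "(\<integral>\<omega>. indicator E \<omega> * D \<omega> \<partial>M) = 0"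
    by (rule EE; simp add: E_def)+
  have E2: "integrable M (\<lambda>\<omega>. indicator (E - T) \<omega> * D \<omega>)" "(\<integral>\<omega>. indicator (E - T) \<omega> * D \<omega> \<partial>M) = 0"
    by (rule ETT; simp add: E_def)+
  have split: "indicator E \<omega> * D \<omega> - indicator (E - T) \<omega> * D \<omega> = indicator T \<omega> * D \<omega>" for \<omega>
    by (auto simp: indicator_def E_def T_def)
  have Ti: "integrable M (\<lambda>\<omega>. indicator T \<omega> * D \<omega>)"
    using Bochner_Integration.integrable_diff[OF E1(1) E2(1)] by (simp add: split)
  have T0: "(\<integral>\<omega>. indicator T \<omega> * D \<omega> \<partial>M) = 0"
    using Bochner_Integration.integral_diff[OF E1(1) E2(1)] E1(2) E2(2) by (simp add: split)
  have neg: "D \<omega> < 0" if "\<omega> \<in> T" for \<omega>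
  proof -
    define a where "a = norm (f \<omega> - x i)"
    have a: "2 * \<rho> < a" "norm (f \<omega> - y) < \<rho>" using that by (auto simp: T_def a_def)
    have "((\<lambda>t. (norm ((f \<omega> - x i) + t *\<^sub>R h) powr p - a powr p) / t) \<longlongrightarrow> D \<omega>) (at 0)"
      using D[of \<omega>] by (simp add: DERIV_def a_def)
    then have lim1: "((\<lambda>t. (norm ((f \<omega> - x i) + t *\<^sub>R h) powr p - a powr p) / t) \<longlongrightarrow> D \<omega>) (at_right 0)"
      by (rule tendsto_mono[rotated]) (simp add: at_le)
    have "((\<lambda>t. (a - t * \<rho>) powr p) has_real_derivative - (\<rho> * (p * a powr (p - 1)))) (at 0)"
      using a \<rho> by (auto intro!: derivative_eq_intros simp: powr_diff field_simps)
    then have "((\<lambda>t. ((a - t * \<rho>) powr p - a powr p) / t) \<longlongrightarrow> - (\<rho> * (p * a powr (p - 1)))) (at 0)"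
      by (simp add: DERIV_def)
    then have lim2: "((\<lambda>t. ((a - t * \<rho>) powr p - a powr p) / t) \<longlongrightarrow> - (\<rho> * (p * a powr (p - 1)))) (at_right 0)"
      by (rule tendsto_mono[rotated]) (simp add: at_le)
    have "\<forall>\<^sub>F t in at_right 0. (norm ((f \<omega> - x i) + t *\<^sub>R h) powr p - a powr p) / t
        \<le> ((a - t * \<rho>) powr p - a powr p) / t"
      unfolding eventually_at_right_field
    proof (intro exI[of _ 1] conjI allI impI)
      fix t :: real assume t: "0 < t" "t < 1"
      have "(f \<omega> - x i) + t *\<^sub>R h = (1 - t) *\<^sub>R (f \<omega> - x i) + t *\<^sub>R (f \<omega> - y)"
        by (simp add: h_def algebra_simps)
      then have "norm ((f \<omega> - x i) + t *\<^sub>R h) \<le> (1 - t) * a + t * norm (f \<omega> - y)"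
        using norm_triangle_ineq[of "(1 - t) *\<^sub>R (f \<omega> - x i)" "t *\<^sub>R (f \<omega> - y)"] t by (simp add: a_def)
      also have "\<dots> \<le> (1 - t) * a + t * (a - \<rho>)"
        using a t by (intro add_left_mono mult_left_mono) auto
      finally have "norm ((f \<omega> - x i) + t *\<^sub>R h) \<le> a - t * \<rho>"
        by (simp add: algebra_simps)
      then have "norm ((f \<omega> - x i) + t *\<^sub>R h) powr p \<le> (a - t * \<rho>) powr p"
        using p by (intro powr_mono2) auto
      then show "(norm ((f \<omega> - x i) + t *\<^sub>R h) powr p - a powr p) / t \<le> ((a - t * \<rho>) powr p - a powr p) / t"
        using t by (intro divide_right_mono) auto
    qed simp
    from tendsto_le[OF _ lim2 lim1 this] have "D \<omega> \<le> - (\<rho> * (p * a powr (p - 1)))"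
      by simp
    moreover have "0 < \<rho> * (p * a powr (p - 1))"
      using \<rho> a p by simp
    ultimately show ?thesis by linarith
  qed
  have "AE \<omega> in M. - (indicator T \<omega> * D \<omega>) = 0"
  proof (subst integral_nonneg_eq_0_iff_AE[symmetric])
    show "integrable M (\<lambda>\<omega>. - (indicator T \<omega> * D \<omega>))"
      using Ti by simp
    show "AE \<omega> in M. 0 \<le> - (indicator T \<omega> * D \<omega>)"
    proof (rule AE_I2)
      show "0 \<le> - (indicator T \<omega> * D \<omega>)" for \<omega>
        using neg[of \<omega>] by (cases "\<omega> \<in> T") auto
    qed
  qed (use T0 in simp)
  with AE_space show ?thesis
  proof eventually_elim
    case (elim \<omega>)
    then have "\<omega> \<notin> T" using neg[of \<omega>] by auto
    with elim(1) show ?case by (simp add: T_def)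
  qed
qed

text \<open>
  At a tie \<open>f\<close> cannot equal \<open>x i\<close>, for then it
  would equal \<open>x j\<close> as well; by separability of the range of \<open>f\<close> the ties are therefore
  covered by countably many of the sets of the preceding lemma.
\<close>

lemma no_ties:
  fixes x :: "nat \<Rightarrow> 'b"
  assumes gd: "gateaux_differentiable_norm TYPE('b)"
    and adm: "admissible K x" and opt: "(\<integral>\<omega>. near K x \<omega> powr p \<partial>M) \<le> V"
    and ij: "i \<in> K" "j \<in> K" "x i \<noteq> x j"
  shows "AE \<omega> in M. \<not> (norm (f \<omega> - x i) = near K x \<omega> \<and> norm (f \<omega> - x j) = near K x \<omega>)"
proof -
  have "strongly_measurable M f" using f by (simp add: Lp_functions_def)
  then obtain y :: "nat \<Rightarrow> 'b"
    where y: "\<forall>\<omega>\<in>space M. \<forall>e>0. \<exists>q. norm (f \<omega> - y q) < e"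
    by (rule strongly_measurable_separable)
  have main: "AE \<omega> in M. \<not> (norm (f \<omega> - x i) = near K x \<omega> \<and> norm (f \<omega> - x j) = near K x \<omega>)"
    if ij: "i \<in> K" "j \<in> K" "x i \<noteq> x j" "x i \<noteq> 0" for i j
  proof -
    have "AE \<omega> in M. \<forall>q N. \<not> (norm (f \<omega> - x i) = near K x \<omega> \<and> norm (f \<omega> - x j) = near K x \<omega> \<and>
        2 * (1 / real (Suc N)) < norm (f \<omega> - x i) \<and> norm (f \<omega> - y q) < 1 / real (Suc N))"
      unfolding AE_all_countable
      by (intro allI no_ties_near_point[OF gd adm opt]) (use ij in auto)
    with AE_space show ?thesis
    proof eventually_elim
      case (elim \<omega>)
      show ?case
      proof
        assume tie: "norm (f \<omega> - x i) = near K x \<omega> \<and> norm (f \<omega> - x j) = near K x \<omega>"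
        have "norm (f \<omega> - x i) \<noteq> 0"
        proof
          assume "norm (f \<omega> - x i) = 0"
          with tie have "f \<omega> = x i" "f \<omega> = x j" by auto
          with ij(3) show False by simp
        qed
        then have "0 < norm (f \<omega> - x i) / 2" by simp
        then obtain N where N: "1 / real (Suc N) < norm (f \<omega> - x i) / 2"
          using reals_Archimedean by (metis inverse_eq_divide)
        obtain q where "norm (f \<omega> - y q) < 1 / real (Suc N)"
          using y elim(1) of_nat_0_less_iff[of "Suc N"] by (metis zero_less_Suc zero_less_divide_1_iff)
        moreover from N have "2 * (1 / real (Suc N)) < norm (f \<omega> - x i)" by linarith
        ultimately show False using tie elim(2) by blast
      qed
    qed
  qed
  \<comment> \<open>Only a nonzero centre may be moved, and at least one of two distinct centres is nonzero.\<close>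
  show ?thesis
  proof (cases "x i = 0")
    case True
    with ij have "x j \<noteq> 0" "x j \<noteq> x i" by auto
    from main[OF ij(2,1) this(2,1)] show ?thesis by (simp add: conj_commute)
  qed (use main ij in blast)
qed

end

section \<open>Limits of minimizing centres\<close>

lemma tendsto_Min:
  fixes a :: "'n \<Rightarrow> 'i \<Rightarrow> real"
  assumes "finite I" "I \<noteq> {}" "\<And>i. i \<in> I \<Longrightarrow> ((\<lambda>n. a n i) \<longlongrightarrow> b i) F"
  shows "((\<lambda>n. Min (a n ` I)) \<longlongrightarrow> Min (b ` I)) F"
  using assms
proof (induction I rule: finite_ne_induct)
  case (insert i I)
  have "Min (a n ` insert i I) = min (a n i) (Min (a n ` I))" for n
    using insert by simp
  moreover have "Min (b ` insert i I) = min (b i) (Min (b ` I))"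
    using insert by simp
  ultimately show ?case
    using insert by (simp only:) (intro tendsto_min; simp)
qed simp

text \<open>
  A minimizing sequence \<open>g\<close> with centres \<open>X n i\<close>, after passage to a subsequence: centres with index in
  \<open>J\<close> have limiting distances \<open>r i\<close> to all values of \<open>f\<close>, the others escape to infinity.
  Convergence of the distances does not yet mean that the centres converge.
\<close>

locale minimizing_centres = quantization M p k f V
  for M :: "'a measure" and p :: real and k :: nat and f :: "'a \<Rightarrow> 'b::banach" and V :: real +
  fixes X :: "nat \<Rightarrow> nat \<Rightarrow> 'b" and J :: "nat set" and r :: "nat \<Rightarrow> 'a \<Rightarrow> real" and g :: "nat \<Rightarrow> 'a \<Rightarrow> 'b"
  assumes uc: "uniformly_convex_norm TYPE('b)" and gd: "gateaux_differentiable_norm TYPE('b)"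
    and J: "J \<subseteq> {..<k}" "J \<noteq> {}"
    and zero: "emeasure M (space M) = \<infinity> \<Longrightarrow> 0 \<in> J" "\<And>n. emeasure M (space M) = \<infinity> \<Longrightarrow> X n 0 = 0"
    and lim: "\<And>i \<omega>. i \<in> J \<Longrightarrow> \<omega> \<in> space M \<Longrightarrow> (\<lambda>n. norm (f \<omega> - X n i)) \<longlonglongrightarrow> r i \<omega>"
    and far: "\<And>i. i < k \<Longrightarrow> i \<notin> J \<Longrightarrow> filterlim (\<lambda>n. norm (X n i)) at_top sequentially"
    and g: "\<And>n. g n \<in> Lp_functions M p"
    and g_val: "\<And>n \<omega>. \<omega> \<in> space M \<Longrightarrow> \<exists>i<k. g n \<omega> = X n i"
    and cost: "(\<lambda>n. \<integral>\<omega>. norm (f \<omega> - g n \<omega>) powr p \<partial>M) \<longlonglongrightarrow> V"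
begin

text \<open>
  The distances of \<open>f\<close> to its nearest centre converge to the following function.
\<close>

definition m :: "'a \<Rightarrow> real" where
  "m \<omega> = Min ((\<lambda>i. r i \<omega>) ` J)"

lemma finite_J: "finite J"
  using J(1) finite_subset by blast

lemma m_le: "i \<in> J \<Longrightarrow> m \<omega> \<le> r i \<omega>"
  using finite_J by (simp add: m_def)

lemma m_attained: "\<exists>i\<in>J. m \<omega> = r i \<omega>"
  using Min_in[of "(\<lambda>i. r i \<omega>) ` J"] finite_J J(2) unfolding m_def by fastforce

lemma admissible_J: "admissible J (X n)"
  using J zero by (simp add: admissible_def)

lemma k_pos: "0 < k"
  using J by auto

lemma admissible_all: "admissible {..<k} (X n)"
  using k_pos zero by (auto simp: admissible_def)

lemma bounded_centre:
  obtains i C where "i \<in> J" "\<And>n. norm (X n i) \<le> C" "emeasure M (space M) = \<infinity> \<Longrightarrow> i = 0"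
proof (cases "emeasure M (space M) = \<infinity>")
  case True
  then show thesis using zero by (intro that[of 0 0]) auto
next
  case False
  obtain i where i: "i \<in> J" using J(2) by blast
  obtain \<omega> where \<omega>: "\<omega> \<in> space M" using space_nonempty by blast
  have "Bseq (\<lambda>n. norm (f \<omega> - X n i))"
    using lim[OF i \<omega>] by (intro convergent_imp_Bseq convergentI)
  then obtain c where c: "\<And>n. norm (f \<omega> - X n i) \<le> c"
    by (auto simp: Bseq_def)
  have "norm (X n i) \<le> norm (f \<omega>) + c" for n
    using norm_triangle_sub[of "X n i" "f \<omega>"] c[of n] by (simp add: norm_minus_commute)
  then show thesis using i False by (intro that[of i]) auto
qed

lemma near_J_bound:
  obtains C where "\<And>n \<omega>. near J (X n) \<omega> powr p \<le> C * W \<omega>"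
proof -
  obtain i C where i: "i \<in> J" "\<And>n. norm (X n i) \<le> C" "emeasure M (space M) = \<infinity> \<Longrightarrow> i = 0"
    by (rule bounded_centre) blast
  have "near J (X n) \<omega> powr p \<le> (1 + C) powr p * W \<omega>" for n \<omega>
    by (rule near_powr_bound[OF finite_J i(1), of "X n" C]) (use i(2,3) zero(2) in auto)
  then show thesis by (rule that)
qed

lemma near_J_tendsto: "\<omega> \<in> space M \<Longrightarrow> (\<lambda>n. near J (X n) \<omega>) \<longlonglongrightarrow> m \<omega>"
  unfolding near_def m_def by (rule tendsto_Min[OF finite_J J(2) lim])

lemma near_all_le: "near {..<k} (X n) \<omega> \<le> near J (X n) \<omega>"
  unfolding near_def using finite_J J by (intro Min_antimono) auto

lemma near_all_tendsto:
  assumes \<omega>: "\<omega> \<in> space M"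
  shows "(\<lambda>n. near {..<k} (X n) \<omega>) \<longlonglongrightarrow> m \<omega>"
proof (rule Lim_transform_eventually[OF near_J_tendsto[OF \<omega>]])
  have "\<forall>\<^sub>F n in sequentially. \<forall>i\<in>{..<k} - J. norm (X n i) > norm (f \<omega>) + (m \<omega> + 1)"
    by (rule eventually_ball_finite) (use far in \<open>auto simp: filterlim_at_top_dense\<close>)
  moreover have "\<forall>\<^sub>F n in sequentially. near J (X n) \<omega> < m \<omega> + 1"
    using near_J_tendsto[OF \<omega>] by (rule order_tendstoD) simp
  ultimately show "\<forall>\<^sub>F n in sequentially. near J (X n) \<omega> = near {..<k} (X n) \<omega>"
  proof eventually_elim
    case (elim n)
    obtain i where i: "i < k" "near {..<k} (X n) \<omega> = norm (f \<omega> - X n i)"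
      using near_attained[of "{..<k}" "X n" \<omega>] k_pos by auto
    have "i \<in> J"
    proof (rule ccontr)
      assume "i \<notin> J"
      then have "norm (X n i) > norm (f \<omega>) + (m \<omega> + 1)" using elim(1) i(1) by auto
      moreover have "norm (X n i) \<le> norm (f \<omega>) + norm (f \<omega> - X n i)"
        using norm_triangle_sub[of "X n i" "f \<omega>"] by (simp add: norm_minus_commute)
      ultimately show False using i(2) elim(2) near_all_le[of n \<omega>] by linarith
    qed
    then have "near J (X n) \<omega> \<le> near {..<k} (X n) \<omega>"
      using near_le[OF finite_J, of i "X n" \<omega>] i(2) by simp
    then show ?case using near_all_le[of n \<omega>] by linarith
  qed
qed

lemma m_nonneg: "\<omega> \<in> space M \<Longrightarrow> 0 \<le> m \<omega>"
  by (rule LIMSEQ_le_const[OF near_J_tendsto]) (use near_nonneg[OF finite_J J(2)] in auto)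

lemma near_all_cost: "(\<lambda>n. \<integral>\<omega>. near {..<k} (X n) \<omega> powr p \<partial>M) \<longlonglongrightarrow> V"
proof (rule tendsto_sandwich[OF _ _ tendsto_const cost])
  show "\<forall>\<^sub>F n in sequentially. V \<le> (\<integral>\<omega>. near {..<k} (X n) \<omega> powr p \<partial>M)"
    using V_le_near[OF admissible_all] by simp
  show "\<forall>\<^sub>F n in sequentially. (\<integral>\<omega>. near {..<k} (X n) \<omega> powr p \<partial>M) \<le> (\<integral>\<omega>. norm (f \<omega> - g n \<omega>) powr p \<partial>M)"
  proof (intro always_eventually allI integral_mono)
    show "integrable M (\<lambda>\<omega>. near {..<k} (X n) \<omega> powr p)" for n
      by (rule integrable_near_powr[OF admissible_all])
    show "integrable M (\<lambda>\<omega>. norm (f \<omega> - g n \<omega>) powr p)" for n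
      by (rule Lp_functions_integrable, rule Lp_functions_diff[OF f g]) (use p in simp)
    fix n \<omega> assume "\<omega> \<in> space M"
    then obtain i where "i < k" "g n \<omega> = X n i" using g_val by blast
    then have "near {..<k} (X n) \<omega> \<le> norm (f \<omega> - g n \<omega>)"
      using near_le[of "{..<k}" i "X n" \<omega>] by simp
    then show "near {..<k} (X n) \<omega> powr p \<le> norm (f \<omega> - g n \<omega>) powr p"
      using near_nonneg[of "{..<k}" "X n" \<omega>] k_pos p by (intro powr_mono2) auto
  qed
qed

lemma near_powr_tendsto:
  assumes "u \<longlonglongrightarrow> m \<omega>" "\<omega> \<in> space M" "\<And>n. 0 \<le> u n"
  shows "(\<lambda>n. u n powr p) \<longlonglongrightarrow> m \<omega> powr p"
  by (rule tendsto_powr2[OF assms(1) tendsto_const]) (use assms(3) p in auto)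

lemma m_measurable [measurable]: "m \<in> borel_measurable M"
  by (rule borel_measurable_LIMSEQ_real[OF near_J_tendsto near_measurable[OF finite_J]])

text \<open>
  The limiting distances attain the optimal cost, although so far no limiting centres are known.
\<close>

lemma m_optimal: "integrable M (\<lambda>\<omega>. m \<omega> powr p)" "(\<integral>\<omega>. m \<omega> powr p \<partial>M) = V"
proof -
  obtain C where C: "\<And>n \<omega>. near J (X n) \<omega> powr p \<le> C * W \<omega>"
    by (rule near_J_bound) blast
  have 0: "(\<lambda>\<omega>. m \<omega> powr p) \<in> borel_measurable M" by measurable
  have 1: "(\<lambda>\<omega>. near {..<k} (X n) \<omega> powr p) \<in> borel_measurable M" for n
    using near_measurable[of "{..<k}" "X n"] by measurable
  have 2: "integrable M (\<lambda>\<omega>. C * W \<omega>)"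
    by (intro integrable_mult_right integrable_W)
  have nn: "0 \<le> near {..<k} (X n) \<omega>" for n \<omega>
    using near_nonneg[of "{..<k}"] k_pos by auto
  have 3: "AE \<omega> in M. (\<lambda>n. near {..<k} (X n) \<omega> powr p) \<longlonglongrightarrow> m \<omega> powr p"
    by (rule AE_I2, rule near_powr_tendsto[OF near_all_tendsto]) (use nn in auto)
  have 4: "AE \<omega> in M. norm (near {..<k} (X n) \<omega> powr p) \<le> C * W \<omega>" for n
  proof (rule AE_I2)
    fix \<omega>
    have "near {..<k} (X n) \<omega> powr p \<le> near J (X n) \<omega> powr p"
      using near_all_le nn p by (intro powr_mono2) auto
    with C[of n \<omega>] show "norm (near {..<k} (X n) \<omega> powr p) \<le> C * W \<omega>" by simp
  qed
  show "integrable M (\<lambda>\<omega>. m \<omega> powr p)"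
    by (rule integrable_dominated_convergence[OF 0 1 2 3 4])
  have "(\<lambda>n. \<integral>\<omega>. near {..<k} (X n) \<omega> powr p \<partial>M) \<longlonglongrightarrow> (\<integral>\<omega>. m \<omega> powr p \<partial>M)"
    by (rule integral_dominated_convergence[OF 0 1 2 3 4])
  with near_all_cost show "(\<integral>\<omega>. m \<omega> powr p \<partial>M) = V"
    by (rule LIMSEQ_unique[rotated])
qed

text \<open>
  This is where uniform convexity enters. If the centres \<open>X n i\<close> were not a Cauchy sequence, replace
  them by midpoints of two of them that stay apart. The new tuples are asymptotically no worse at
  every point, and being admissible they are no better on the whole, so along a subsequence their nearest
  distances tend to \<open>m\<close> almost everywhere. At a single point with \<open>r i = m\<close> the midpoint is
  then asymptotically as far from \<open>f\<close> as its two endpoints, which uniform convexity forbids.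
\<close>

lemma essential_centre_convergent:
  assumes i: "i \<in> J" and ess: "\<not> (AE \<omega> in M. r i \<omega> \<noteq> m \<omega>)"
  shows "convergent (\<lambda>n. X n i)"
proof (cases "emeasure M (space M) = \<infinity> \<and> i = 0")
  case True
  then show ?thesis using zero(2) by (auto simp: convergent_const)
next
  case i0: False
  show ?thesis
  proof (rule ccontr)
    assume "\<not> convergent (\<lambda>n. X n i)"
    then have "\<not> Cauchy (\<lambda>n. X n i)"
      by (simp add: Cauchy_convergent_iff)
    then obtain e where e: "0 < e" "\<forall>N. \<exists>a\<ge>N. \<exists>b\<ge>N. e \<le> norm (X a i - X b i)"
      unfolding Cauchy_def dist_norm not_all not_ex not_imp not_less by blast
    then obtain a b where ab: "\<And>N. N \<le> a N" "\<And>N. N \<le> b N" "\<And>N. e \<le> norm (X (a N) i - X (b N) i)"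
      by metis
    have a_top: "filterlim a at_top sequentially" and b_top: "filterlim b at_top sequentially"
      by (rule filterlim_at_top_mono[OF filterlim_ident]; use ab in simp)+
    define Y where "Y N = (X (a N))(i := (1/2) *\<^sub>R (X (a N) i + X (b N) i))" for N
    have admY: "admissible J (Y N)" for N
      using admissible_J[of "a N"] i0 by (auto simp: admissible_def Y_def)
    define u where "u N \<omega> = near J (Y N) \<omega> powr p" for N \<omega>
    define avg where "avg N \<omega> = (norm (f \<omega> - X (a N) i) + norm (f \<omega> - X (b N) i)) / 2" for N \<omega>
    have mid: "f \<omega> - Y N i = (1/2) *\<^sub>R ((f \<omega> - X (a N) i) + (f \<omega> - X (b N) i))" for \<omega> N
      unfolding Y_def fun_upd_same by (simp add: algebra_simps flip: scaleR_add_left)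
    have Y_avg: "norm (f \<omega> - Y N i) \<le> avg N \<omega>" for \<omega> N
      unfolding mid avg_def using norm_triangle_ineq[of "f \<omega> - X (a N) i" "f \<omega> - X (b N) i"] by simp
    have lim_ab: "(\<lambda>N. norm (f \<omega> - X (a N) j)) \<longlonglongrightarrow> r j \<omega>" "(\<lambda>N. norm (f \<omega> - X (b N) j)) \<longlonglongrightarrow> r j \<omega>"
      if "\<omega> \<in> space M" "j \<in> J" for \<omega> j
      using filterlim_compose[OF lim[OF that(2,1)] a_top] filterlim_compose[OF lim[OF that(2,1)] b_top]
      by simp_all
    have avg_lim: "(\<lambda>N. avg N \<omega>) \<longlonglongrightarrow> r i \<omega>" if "\<omega> \<in> space M" for \<omega>
      using tendsto_divide[OF tendsto_add[OF lim_ab[OF that i]] tendsto_const[of 2]] by (simp add: avg_def)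
    \<comment> \<open>An upper bound for the nearest distance of the modified tuple whose limit is evident.\<close>
    define z where "z N \<omega> = Min ((\<lambda>j. if j = i then avg N \<omega> else norm (f \<omega> - X (a N) j)) ` J)" for N \<omega>
    have z_lim: "(\<lambda>N. z N \<omega>) \<longlonglongrightarrow> m \<omega>" if \<omega>: "\<omega> \<in> space M" for \<omega>
      unfolding z_def m_def
    proof (rule tendsto_Min[OF finite_J J(2)])
      show "(\<lambda>N. if j = i then avg N \<omega> else norm (f \<omega> - X (a N) j)) \<longlonglongrightarrow> r j \<omega>" if "j \<in> J" for j
        using avg_lim[OF \<omega>] lim_ab(1)[OF \<omega> that] by (cases "j = i") auto
    qed
    have near_z: "near J (Y N) \<omega> \<le> z N \<omega>" for N \<omega>
    proof -
      have "z N \<omega> \<in> (\<lambda>j. if j = i then avg N \<omega> else norm (f \<omega> - X (a N) j)) ` J"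
        unfolding z_def using finite_J J(2) by (intro Min_in) auto
      then obtain j where j: "j \<in> J" "z N \<omega> = (if j = i then avg N \<omega> else norm (f \<omega> - X (a N) j))"
        by blast
      have "near J (Y N) \<omega> \<le> norm (f \<omega> - Y N j)"
        by (rule near_le[OF finite_J j(1)])
      also have "\<dots> \<le> z N \<omega>"
        using Y_avg[of \<omega> N] j(2) by (cases "j = i") (auto simp: Y_def)
      finally show ?thesis .
    qed
    have nn: "0 \<le> near J (Y N) \<omega>" for N \<omega>
      by (rule near_nonneg[OF finite_J J(2)])
    obtain i1 C where i1: "i1 \<in> J" "\<And>n. norm (X n i1) \<le> C" "emeasure M (space M) = \<infinity> \<Longrightarrow> i1 = 0"
      by (rule bounded_centre) blast
    have YC: "norm (Y N i1) \<le> C" for N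
    proof (cases "i1 = i")
      case True
      then show ?thesis
        using norm_triangle_ineq[of "X (a N) i" "X (b N) i"] i1(2)[of "a N"] i1(2)[of "b N"]
        by (simp add: Y_def)
    qed (use i1(2) in \<open>simp add: Y_def\<close>)
    have "\<exists>\<sigma>::nat \<Rightarrow> nat. strict_mono \<sigma> \<and> (AE \<omega> in M. (\<lambda>n. u (\<sigma> n) \<omega>) \<longlonglongrightarrow> m \<omega> powr p)"
    proof (rule L1_convergence_of_minimizing)
      show "u N \<in> borel_measurable M" for N
        unfolding u_def[abs_def] using near_measurable[OF finite_J, of "Y N"] by measurable
      show "integrable M (\<lambda>\<omega>. m \<omega> powr p)" by (rule m_optimal)
      show "integrable M (\<lambda>\<omega>. (1 + C) powr p * W \<omega>)"
        by (intro integrable_mult_right integrable_W)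
      show "0 \<le> u N \<omega> \<and> u N \<omega> \<le> (1 + C) powr p * W \<omega>" for N \<omega>
      proof -
        have "near J (Y N) \<omega> powr p \<le> (1 + C) powr p * W \<omega>"
          using admY[of N] i1(3) by (intro near_powr_bound[OF finite_J i1(1), of "Y N" C, OF YC]) (auto simp: admissible_def)
        then show ?thesis by (simp add: u_def)
      qed
      show "(\<integral>\<omega>. m \<omega> powr p \<partial>M) \<le> (\<integral>\<omega>. u N \<omega> \<partial>M)" for N
        using V_le_near[OF admY] m_optimal(2) by (simp add: u_def)
      fix \<omega> and \<epsilon> :: real assume \<omega>: "\<omega> \<in> space M" and "0 < \<epsilon>"
      have "(\<lambda>N. z N \<omega> powr p) \<longlonglongrightarrow> m \<omega> powr p"
        by (rule near_powr_tendsto[OF z_lim[OF \<omega>] \<omega>]) (use nn near_z order_trans in blast)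
      then have "\<forall>\<^sub>F N in sequentially. z N \<omega> powr p < m \<omega> powr p + \<epsilon>"
        by (rule order_tendstoD) (use \<open>0 < \<epsilon>\<close> in simp)
      then show "\<forall>\<^sub>F N in sequentially. u N \<omega> < m \<omega> powr p + \<epsilon>"
      proof eventually_elim
        case (elim N)
        have "u N \<omega> \<le> z N \<omega> powr p"
          unfolding u_def using near_z nn p by (intro powr_mono2) auto
        with elim show ?case by linarith
      qed
    qed blast
    then obtain \<sigma> :: "nat \<Rightarrow> nat" where \<sigma>: "strict_mono \<sigma>" "AE \<omega> in M. (\<lambda>n. u (\<sigma> n) \<omega>) \<longlonglongrightarrow> m \<omega> powr p"
      by blast
    have "\<exists>\<omega>\<in>space M. r i \<omega> = m \<omega> \<and> (\<lambda>n. u (\<sigma> n) \<omega>) \<longlonglongrightarrow> m \<omega> powr p"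
    proof (rule ccontr)
      assume no: "\<not> ?thesis"
      from \<sigma>(2) AE_space have "AE \<omega> in M. r i \<omega> \<noteq> m \<omega>"
        by eventually_elim (use no in blast)
      with ess show False by blast
    qed
    then obtain \<omega> where \<omega>: "\<omega> \<in> space M" and rm: "r i \<omega> = m \<omega>" and ulim: "(\<lambda>n. u (\<sigma> n) \<omega>) \<longlonglongrightarrow> m \<omega> powr p"
      by blast
    have "(\<lambda>n. u (\<sigma> n) \<omega> powr (1 / p)) \<longlonglongrightarrow> (m \<omega> powr p) powr (1 / p)"
      by (rule tendsto_powr2[OF ulim tendsto_const]) (use p in \<open>auto simp: u_def\<close>)
    then have near_lim: "(\<lambda>n. near J (Y (\<sigma> n)) \<omega>) \<longlonglongrightarrow> m \<omega>"
      using p nn m_nonneg[OF \<omega>] by (simp add: u_def powr_powr)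
    have sub: "filterlim \<sigma> at_top sequentially"
      by (rule filterlim_subseq) fact
    have mid_lim: "(\<lambda>n. norm (f \<omega> - Y (\<sigma> n) i)) \<longlonglongrightarrow> m \<omega>"
    proof (rule tendsto_sandwich[OF _ _ near_lim])
      show "\<forall>\<^sub>F n in sequentially. near J (Y (\<sigma> n)) \<omega> \<le> norm (f \<omega> - Y (\<sigma> n) i)"
        using near_le[OF finite_J i] by simp
      show "\<forall>\<^sub>F n in sequentially. norm (f \<omega> - Y (\<sigma> n) i) \<le> avg (\<sigma> n) \<omega>"
        using Y_avg by simp
      show "(\<lambda>n. avg (\<sigma> n) \<omega>) \<longlonglongrightarrow> m \<omega>"
        using filterlim_compose[OF avg_lim[OF \<omega>] sub] rm by simp
    qed
    have "(\<lambda>n. (f \<omega> - X (a (\<sigma> n)) i) - (f \<omega> - X (b (\<sigma> n)) i)) \<longlonglongrightarrow> 0"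
    proof (rule uniformly_convex_norm_tendsto[OF uc])
      show "(\<lambda>n. norm (f \<omega> - X (a (\<sigma> n)) i)) \<longlonglongrightarrow> m \<omega>" "(\<lambda>n. norm (f \<omega> - X (b (\<sigma> n)) i)) \<longlonglongrightarrow> m \<omega>"
        using filterlim_compose[OF lim_ab(1)[OF \<omega> i] sub] filterlim_compose[OF lim_ab(2)[OF \<omega> i] sub] rm
        by simp_all
      show "(\<lambda>n. norm ((1/2) *\<^sub>R ((f \<omega> - X (a (\<sigma> n)) i) + (f \<omega> - X (b (\<sigma> n)) i)))) \<longlonglongrightarrow> m \<omega>"
        using mid_lim unfolding mid .
    qed
    from tendsto_norm_zero[OF this]
    have "(\<lambda>n. norm (X (a (\<sigma> n)) i - X (b (\<sigma> n)) i)) \<longlonglongrightarrow> 0"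
      by (simp add: norm_minus_commute)
    then have "e \<le> 0"
      by (rule LIMSEQ_le_const) (use ab(3) in auto)
    with e(1) show False by simp
  qed
qed

text \<open>
  By the preceding lemma these indices suffice: almost everywhere all limiting distances equal to \<open>m\<close>
  belong to them.
\<close>

definition K :: "nat set" where
  "K = {i \<in> J. convergent (\<lambda>n. X n i)}"

definition x :: "nat \<Rightarrow> 'b" where
  "x i = Topological_Spaces.lim (\<lambda>n. X n i)"

lemma x_lim: "i \<in> K \<Longrightarrow> (\<lambda>n. X n i) \<longlonglongrightarrow> x i"
  by (simp add: K_def x_def convergent_LIMSEQ_iff)

lemma r_eq:
  assumes "i \<in> K" "\<omega> \<in> space M"
  shows "r i \<omega> = norm (f \<omega> - x i)"
proof (rule LIMSEQ_unique)
  show "(\<lambda>n. norm (f \<omega> - X n i)) \<longlonglongrightarrow> r i \<omega>"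
    using assms by (intro lim) (auto simp: K_def)
  show "(\<lambda>n. norm (f \<omega> - X n i)) \<longlonglongrightarrow> norm (f \<omega> - x i)"
    by (intro tendsto_norm tendsto_diff tendsto_const x_lim assms)
qed

lemma AE_attained_in_K: "AE \<omega> in M. \<forall>i\<in>J. r i \<omega> = m \<omega> \<longrightarrow> i \<in> K"
proof (rule AE_finite_allI[OF finite_J])
  fix i assume i: "i \<in> J"
  show "AE \<omega> in M. r i \<omega> = m \<omega> \<longrightarrow> i \<in> K"
  proof (cases "AE \<omega> in M. r i \<omega> \<noteq> m \<omega>")
    case True
    then show ?thesis by eventually_elim simp
  next
    case False
    then have "i \<in> K" using essential_centre_convergent[OF i] i by (simp add: K_def)
    then show ?thesis by simp
  qed
qed

lemma admissible_K: "admissible K x"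
proof -
  obtain \<omega> where "\<forall>i\<in>J. r i \<omega> = m \<omega> \<longrightarrow> i \<in> K"
    using AE_exists[OF AE_attained_in_K] by blast
  then have "K \<noteq> {}" using m_attained[of \<omega>] by force
  moreover have "0 \<in> K \<and> x 0 = 0" if inf: "emeasure M (space M) = \<infinity>"
  proof -
    have *: "(\<lambda>n. X n 0) = (\<lambda>n. 0)" using zero(2)[OF inf] by simp
    then show ?thesis
      unfolding K_def x_def * using zero(1)[OF inf] by (auto simp: convergent_const * intro!: limI)
  qed
  ultimately show ?thesis
    using J(1) by (auto simp: admissible_def K_def)
qed

lemma AE_near_K: "AE \<omega> in M. near K x \<omega> = m \<omega>"
  using AE_attained_in_K AE_space
proof eventually_elim
  case (elim \<omega>)
  note fin = admissible_finite[OF admissible_K]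
  obtain i where i: "i \<in> J" "m \<omega> = r i \<omega>" using m_attained by blast
  then have "i \<in> K" using elim(1) by simp
  then have le: "near K x \<omega> \<le> m \<omega>"
    using near_le[OF fin(1), of i x \<omega>] r_eq[of i \<omega>] i(2) elim(2) by simp
  obtain l where l: "l \<in> K" "near K x \<omega> = norm (f \<omega> - x l)"
    using near_attained[OF fin] by blast
  then have "m \<omega> \<le> near K x \<omega>"
    using m_le[of l \<omega>] r_eq[of l \<omega>] elim(2) by (simp add: K_def)
  with le show ?case by simp
qed

lemma optimal_K: "(\<integral>\<omega>. near K x \<omega> powr p \<partial>M) = V"
proof -
  have [measurable]: "near K x \<in> borel_measurable M"
    by (rule near_measurable[OF admissible_finite(1)[OF admissible_K]])
  have "(\<integral>\<omega>. near K x \<omega> powr p \<partial>M) = (\<integral>\<omega>. m \<omega> powr p \<partial>M)"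
    by (rule integral_cong_AE) (use AE_near_K in auto)
  then show ?thesis using m_optimal(2) by simp
qed

text \<open>
  Ties between centres with the same limit do no harm; those between different limits are negligible since
  the limiting tuple is optimal.
\<close>

lemma AE_unique_limit_centre: "AE \<omega> in M. \<forall>i\<in>J. \<forall>j\<in>J. r i \<omega> = m \<omega> \<longrightarrow> r j \<omega> = m \<omega> \<longrightarrow> i \<in> K \<and> j \<in> K \<and> x i = x j"
proof -
  have fin: "finite K" by (rule admissible_finite(1)[OF admissible_K])
  have "AE \<omega> in M. \<forall>i\<in>K. \<forall>j\<in>K. x i \<noteq> x j \<longrightarrow>
      \<not> (norm (f \<omega> - x i) = near K x \<omega> \<and> norm (f \<omega> - x j) = near K x \<omega>)"
  proof (intro AE_finite_allI fin)
    fix i j assume ij: "i \<in> K" "j \<in> K"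
    show "AE \<omega> in M. x i \<noteq> x j \<longrightarrow>
      \<not> (norm (f \<omega> - x i) = near K x \<omega> \<and> norm (f \<omega> - x j) = near K x \<omega>)"
    proof (cases "x i = x j")
      case False
      have "AE \<omega> in M. \<not> (norm (f \<omega> - x i) = near K x \<omega> \<and> norm (f \<omega> - x j) = near K x \<omega>)"
        by (rule no_ties[OF gd admissible_K _ ij False]) (simp add: optimal_K)
      then show ?thesis by eventually_elim simp
    qed simp
  qed
  with AE_attained_in_K AE_near_K AE_space show ?thesis
    by eventually_elim (metis r_eq)
qed

text \<open>
  Since \<open>g\<^sub>n\<close> is asymptotically as good as the nearest centres, along a subsequence
  \<open>\<parallel>f - g\<^sub>n\<parallel> \<longlonglongrightarrow> m\<close> almost everywhere. So \<open>g\<^sub>n\<close> eventually only uses centres whose limiting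
  distance is \<open>m\<close>, and these have a common limit; whatever the partitions do,
  \<open>g\<^sub>n\<close> converges almost everywhere to the nearest-centre function of the limits. Up to the terms
  \<open>e n\<close>, which vanish in \<open>L\<^sup>1\<close>, everything is dominated, which gives convergence in \<open>L\<^sup>p\<close>.
\<close>

lemma subsequence_converges:
  obtains h and \<sigma> :: "nat \<Rightarrow> nat" where "h \<in> G_functions M p k" "strict_mono \<sigma>"
    "(\<lambda>n. \<integral>\<omega>. norm (g (\<sigma> n) \<omega> - h \<omega>) powr p \<partial>M) \<longlonglongrightarrow> 0"
proof -
  obtain h where hG: "h \<in> G_functions M p k"
    and h: "\<And>\<omega>. \<omega> \<in> space M \<Longrightarrow> \<exists>i\<in>K. h \<omega> = x i \<and> norm (f \<omega> - x i) = near K x \<omega>"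
    using nearest_function[OF admissible_K] by blast
  have hL: "h \<in> Lp_functions M p" using hG by (simp add: G_functions_def)
  have p0: "0 \<le> p" using p by simp
  define e where "e n \<omega> = norm (f \<omega> - g n \<omega>) powr p - near {..<k} (X n) \<omega> powr p" for n \<omega>
  have ifg: "integrable M (\<lambda>\<omega>. norm (f \<omega> - g n \<omega>) powr p)" for n
    by (rule Lp_functions_integrable, rule Lp_functions_diff[OF f g p0])
  have ie: "integrable M (e n)" for n
    unfolding e_def[abs_def]
    by (intro Bochner_Integration.integrable_diff ifg integrable_near_powr[OF admissible_all])
  have all_le: "near {..<k} (X n) \<omega> \<le> norm (f \<omega> - g n \<omega>)" if \<omega>: "\<omega> \<in> space M" for n \<omega>
  proof -
    obtain i where "i < k" "g n \<omega> = X n i" using g_val[OF \<omega>] by blast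
    then show ?thesis using near_le[of "{..<k}" i "X n" \<omega>] by simp
  qed
  have all_nonneg: "0 \<le> near {..<k} (X n) \<omega>" for n \<omega>
    using near_nonneg[of "{..<k}"] k_pos by auto
  have e_nonneg: "0 \<le> e n \<omega>" if "\<omega> \<in> space M" for n \<omega>
    using all_le[OF that, of n] all_nonneg[of n \<omega>] p by (simp add: e_def powr_mono2)
  have e_lim: "(\<lambda>n. \<integral>\<omega>. e n \<omega> \<partial>M) \<longlonglongrightarrow> 0"
  proof -
    have "(\<lambda>n. (\<integral>\<omega>. norm (f \<omega> - g n \<omega>) powr p \<partial>M) - (\<integral>\<omega>. near {..<k} (X n) \<omega> powr p \<partial>M)) \<longlonglongrightarrow> V - V"
      by (rule tendsto_diff[OF cost near_all_cost])
    then show ?thesis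
      unfolding e_def using ifg integrable_near_powr[OF admissible_all] by simp
  qed
  have "(\<lambda>n. \<integral>\<omega>. norm (e n \<omega>) \<partial>M) \<longlonglongrightarrow> 0"
  proof -
    have "(\<integral>\<omega>. norm (e n \<omega>) \<partial>M) = (\<integral>\<omega>. e n \<omega> \<partial>M)" for n
      by (rule Bochner_Integration.integral_cong) (use e_nonneg in auto)
    with e_lim show ?thesis by simp
  qed
  then obtain \<sigma> where \<sigma>: "strict_mono \<sigma>" and e_ae: "AE \<omega> in M. (\<lambda>n. e (\<sigma> n) \<omega>) \<longlonglongrightarrow> 0"
    using tendsto_L1_AE_subseq[of M e, OF ie] by blast
  have sub: "filterlim \<sigma> at_top sequentially"
    by (rule filterlim_subseq) fact
  have g_ae: "AE \<omega> in M. (\<lambda>n. norm (g (\<sigma> n) \<omega> - h \<omega>)) \<longlonglongrightarrow> 0"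
    using e_ae AE_unique_limit_centre AE_near_K AE_space
  proof eventually_elim
    case (elim \<omega>)
    note \<omega> = elim(4)
    obtain l where l: "l \<in> K" "h \<omega> = x l" "norm (f \<omega> - x l) = near K x \<omega>"
      using h[OF \<omega>] by blast
    have lJ: "l \<in> J" using l(1) by (simp add: K_def)
    have rl: "r l \<omega> = m \<omega>" using r_eq[OF l(1) \<omega>] l(3) elim(3) by simp
    have "(\<lambda>n. e (\<sigma> n) \<omega> + near {..<k} (X (\<sigma> n)) \<omega> powr p) \<longlonglongrightarrow> 0 + m \<omega> powr p"
      by (intro tendsto_add elim(1) near_powr_tendsto[OF _ \<omega>]
          filterlim_compose[OF near_all_tendsto[OF \<omega>] sub] all_nonneg)
    then have "(\<lambda>n. norm (f \<omega> - g (\<sigma> n) \<omega>) powr p) \<longlonglongrightarrow> m \<omega> powr p"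
      by (simp add: e_def)
    from tendsto_powr2[OF this tendsto_const, of "1 / p"]
    have "(\<lambda>n. (norm (f \<omega> - g (\<sigma> n) \<omega>) powr p) powr (1 / p)) \<longlonglongrightarrow> (m \<omega> powr p) powr (1 / p)"
      using p by simp
    then have fg_lim: "(\<lambda>n. norm (f \<omega> - g (\<sigma> n) \<omega>)) \<longlonglongrightarrow> m \<omega>"
      using p m_nonneg[OF \<omega>] by (simp add: powr_powr)
    show ?case
    proof (rule LIMSEQ_I)
      fix \<epsilon> :: real assume \<epsilon>: "0 < \<epsilon>"
      have "\<forall>\<^sub>F n in sequentially. g (\<sigma> n) \<omega> = X (\<sigma> n) i \<longrightarrow> norm (g (\<sigma> n) \<omega> - h \<omega>) < \<epsilon>"
        if i: "i < k" for i
      proof (cases "i \<in> J")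
        case False
        have "\<forall>\<^sub>F n in sequentially. norm (X (\<sigma> n) i) > norm (f \<omega>) + (m \<omega> + 1)"
          using filterlim_compose[OF far[OF i False] sub] by (simp add: filterlim_at_top_dense)
        moreover have "\<forall>\<^sub>F n in sequentially. norm (f \<omega> - g (\<sigma> n) \<omega>) < m \<omega> + 1"
          using fg_lim by (rule order_tendstoD) simp
        ultimately show ?thesis
        proof eventually_elim
          case (elim n)
          have "norm (X (\<sigma> n) i) \<le> norm (f \<omega>) + norm (f \<omega> - X (\<sigma> n) i)"
            using norm_triangle_sub[of "X (\<sigma> n) i" "f \<omega>"] by (simp add: norm_minus_commute)
          with elim show ?case by auto
        qed
      next
        case True
        have i_lim: "(\<lambda>n. norm (f \<omega> - X (\<sigma> n) i)) \<longlonglongrightarrow> r i \<omega>"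
          using filterlim_compose[OF lim[OF True \<omega>] sub] .
        show ?thesis
        proof (cases "r i \<omega> = m \<omega>")
          case eq: True
          then have iK: "i \<in> K" and "x i = x l"
            using elim(2) True lJ rl by blast+
          then have "(\<lambda>n. X (\<sigma> n) i) \<longlonglongrightarrow> h \<omega>"
            using filterlim_compose[OF x_lim[OF iK] sub] l(2) by simp
          from LIMSEQ_D[OF this \<epsilon>] show ?thesis
            by (auto simp: eventually_sequentially)
        next
          case False
          then have less: "m \<omega> < (m \<omega> + r i \<omega>) / 2" "(m \<omega> + r i \<omega>) / 2 < r i \<omega>"
            using m_le[OF True, of \<omega>] by auto
          from order_tendstoD(1)[OF i_lim less(2)] order_tendstoD(2)[OF fg_lim less(1)]
          show ?thesis by eventually_elim auto
        qed
      qed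
      then have "\<forall>\<^sub>F n in sequentially. \<forall>i\<in>{..<k}. g (\<sigma> n) \<omega> = X (\<sigma> n) i \<longrightarrow> norm (g (\<sigma> n) \<omega> - h \<omega>) < \<epsilon>"
        by (intro eventually_ball_finite) auto
      then have "\<forall>\<^sub>F n in sequentially. norm (norm (g (\<sigma> n) \<omega> - h \<omega>) - 0) < \<epsilon>"
      proof eventually_elim
        case (elim n)
        then show ?case using g_val[OF \<omega>, of "\<sigma> n"] by auto
      qed
      then show "\<exists>no. \<forall>n\<ge>no. norm (norm (g (\<sigma> n) \<omega> - h \<omega>) - 0) < \<epsilon>"
        by (simp add: eventually_sequentially)
    qed
  qed
  define c where "c = 2 powr p"
  have c: "0 \<le> c" by (simp add: c_def)
  obtain C where C: "\<And>n \<omega>. near J (X n) \<omega> powr p \<le> C * W \<omega>"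
    by (rule near_J_bound) blast
  define w where "w \<omega> = c * (C * W \<omega> + near K x \<omega> powr p)" for \<omega>
  have iw: "integrable M w"
    unfolding w_def[abs_def]
    by (intro integrable_mult_right Bochner_Integration.integrable_add integrable_W
        integrable_near_powr[OF admissible_K])
  have bound: "norm (g n \<omega> - h \<omega>) powr p \<le> w \<omega> + c * e n \<omega>" if \<omega>: "\<omega> \<in> space M" for n \<omega>
  proof -
    have "norm (g n \<omega> - h \<omega>) \<le> norm (f \<omega> - g n \<omega>) + norm (f \<omega> - h \<omega>)"
      using norm_triangle_ineq4[of "f \<omega> - h \<omega>" "f \<omega> - g n \<omega>"] by simp
    then have "norm (g n \<omega> - h \<omega>) powr p \<le> (norm (f \<omega> - g n \<omega>) + norm (f \<omega> - h \<omega>)) powr p"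
      using p by (intro powr_mono2) auto
    also have "\<dots> \<le> c * (norm (f \<omega> - g n \<omega>) powr p + norm (f \<omega> - h \<omega>) powr p)"
      unfolding c_def using p by (intro powr_add_le) auto
    also have "norm (f \<omega> - h \<omega>) = near K x \<omega>"
      using h[OF \<omega>] by auto
    finally have 1: "norm (g n \<omega> - h \<omega>) powr p \<le> c * (norm (f \<omega> - g n \<omega>) powr p + near K x \<omega> powr p)" .
    have "near {..<k} (X n) \<omega> powr p \<le> near J (X n) \<omega> powr p"
      using near_all_le all_nonneg p by (intro powr_mono2) auto
    then have "norm (f \<omega> - g n \<omega>) powr p \<le> C * W \<omega> + e n \<omega>"
      using C[of n \<omega>] by (simp add: e_def)
    then have "c * (norm (f \<omega> - g n \<omega>) powr p + near K x \<omega> powr p) \<le> c * (C * W \<omega> + e n \<omega> + near K x \<omega> powr p)"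
      using c by (intro mult_left_mono) auto
    with 1 show ?thesis by (simp add: w_def algebra_simps)
  qed
  \<comment> \<open>Subtracting the excess \<open>c * e n\<close> leaves a function dominated by \<open>w\<close>.\<close>
  define q where "q n \<omega> = max (norm (g n \<omega> - h \<omega>) powr p - c * e n \<omega>) 0" for n \<omega>
  have igh: "integrable M (\<lambda>\<omega>. norm (g n \<omega> - h \<omega>) powr p)" for n
    by (rule Lp_functions_integrable, rule Lp_functions_diff[OF g hL p0])
  have iq: "integrable M (q n)" for n
    unfolding q_def[abs_def]
    by (intro integrable_max Bochner_Integration.integrable_diff igh integrable_mult_right ie) simp
  have "(\<lambda>n. \<integral>\<omega>. q (\<sigma> n) \<omega> \<partial>M) \<longlonglongrightarrow> (\<integral>\<omega>. 0 \<partial>M)"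
  proof (rule integral_dominated_convergence)
    show "integrable M w" by (rule iw)
    show "q (\<sigma> n) \<in> borel_measurable M" for n
      by (rule borel_measurable_integrable[OF iq])
    show "AE \<omega> in M. norm (q (\<sigma> n) \<omega>) \<le> w \<omega>" for n
    proof (rule AE_I2)
      fix \<omega> assume \<omega>: "\<omega> \<in> space M"
      have "0 \<le> C * W \<omega>" using C[of 0 \<omega>] powr_ge_zero[of "near J (X 0) \<omega>" p] by linarith
      then have "0 \<le> w \<omega>" using c by (simp add: w_def)
      then show "norm (q (\<sigma> n) \<omega>) \<le> w \<omega>"
        using bound[OF \<omega>, of "\<sigma> n"] by (simp add: q_def)
    qed
    show "AE \<omega> in M. (\<lambda>n. q (\<sigma> n) \<omega>) \<longlonglongrightarrow> 0"
      using g_ae e_ae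
    proof eventually_elim
      case (elim \<omega>)
      have 1: "(\<lambda>n. norm (g (\<sigma> n) \<omega> - h \<omega>) powr p) \<longlonglongrightarrow> 0 powr p"
        by (rule tendsto_powr2[OF elim(1) tendsto_const]) (use p in auto)
      have "(\<lambda>n. q (\<sigma> n) \<omega>) \<longlonglongrightarrow> max (0 powr p - c * 0) 0"
        unfolding q_def by (intro tendsto_max tendsto_diff tendsto_mult tendsto_const 1 elim(2))
      then show ?case by simp
    qed
  qed simp
  then have q_lim: "(\<lambda>n. (\<integral>\<omega>. q (\<sigma> n) \<omega> \<partial>M) + c * (\<integral>\<omega>. e (\<sigma> n) \<omega> \<partial>M)) \<longlonglongrightarrow> 0 + c * 0"
    by (intro tendsto_add tendsto_mult tendsto_const filterlim_compose[OF e_lim sub]) simp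
  have "(\<lambda>n. \<integral>\<omega>. norm (g (\<sigma> n) \<omega> - h \<omega>) powr p \<partial>M) \<longlonglongrightarrow> 0"
  proof (rule tendsto_sandwich[OF _ _ tendsto_const])
    show "(\<lambda>n. (\<integral>\<omega>. q (\<sigma> n) \<omega> \<partial>M) + c * (\<integral>\<omega>. e (\<sigma> n) \<omega> \<partial>M)) \<longlonglongrightarrow> 0"
      using q_lim by simp
    have "(\<integral>\<omega>. norm (g n \<omega> - h \<omega>) powr p \<partial>M) \<le> (\<integral>\<omega>. q n \<omega> \<partial>M) + c * (\<integral>\<omega>. e n \<omega> \<partial>M)" for n
    proof -
      have "(\<integral>\<omega>. norm (g n \<omega> - h \<omega>) powr p \<partial>M) \<le> (\<integral>\<omega>. q n \<omega> + c * e n \<omega> \<partial>M)"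
      proof (rule integral_mono)
        show "integrable M (\<lambda>\<omega>. q n \<omega> + c * e n \<omega>)"
          by (intro Bochner_Integration.integrable_add integrable_mult_right iq ie)
      qed (auto intro!: igh simp: q_def)
      also have "\<dots> = (\<integral>\<omega>. q n \<omega> \<partial>M) + c * (\<integral>\<omega>. e n \<omega> \<partial>M)"
        using iq ie by simp
      finally show ?thesis .
    qed
    then show "\<forall>\<^sub>F n in sequentially. (\<integral>\<omega>. norm (g (\<sigma> n) \<omega> - h \<omega>) powr p \<partial>M)
        \<le> (\<integral>\<omega>. q (\<sigma> n) \<omega> \<partial>M) + c * (\<integral>\<omega>. e (\<sigma> n) \<omega> \<partial>M)"
      by simp
  qed simp
  with hG \<sigma> show thesis by (rule that)
qed

end

section \<open>Approximative compactness\<close>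

text \<open>
  Over an infinite measure some part of the partition has infinite measure, and the value there is
  \<open>0\<close> by integrability; exchanging two indices makes it the value number \<open>0\<close>.
\<close>

lemma G_functions_centres:
  fixes g :: "'a \<Rightarrow> 'b::real_normed_vector"
  assumes g: "g \<in> G_functions M p k" and nonempty: "space M \<noteq> {}"
  shows "\<exists>c. (\<forall>\<omega>\<in>space M. \<exists>i<k. g \<omega> = c i) \<and> (emeasure M (space M) = \<infinity> \<longrightarrow> c 0 = 0)"
proof -
  obtain l A y where l: "l \<le> k" and A: "\<forall>i<l. A i \<in> sets M" and disj: "disjoint_family_on A {..<l}"
    and un: "(\<Union>i<l. A i) = space M" and g_eq: "g = (\<lambda>\<omega>. \<Sum>i<l. indicator (A i) \<omega> *\<^sub>R y i)"
    using g unfolding G_functions_def by blast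
  have g_val: "g \<omega> = y i" if "i < l" "\<omega> \<in> A i" for \<omega> i
  proof -
    have "g \<omega> = (\<Sum>j<l. if j = i then y i else 0)"
      unfolding g_eq
    proof (intro sum.cong refl)
      fix j assume "j \<in> {..<l}"
      then have "\<omega> \<notin> A j" if "j \<noteq> i"
        using disj \<open>i < l\<close> \<open>\<omega> \<in> A i\<close> that unfolding disjoint_family_on_def by blast
      then show "indicator (A j) \<omega> *\<^sub>R y j = (if j = i then y i else 0)"
        using \<open>\<omega> \<in> A i\<close> by (cases "j = i") simp_all
    qed
    then show ?thesis using that by simp
  qed
  have val: "\<exists>i<l. g \<omega> = y i" if "\<omega> \<in> space M" for \<omega>
    using that un g_val by blast
  show ?thesis
  proof (cases "emeasure M (space M) = \<infinity>")
    case False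
    moreover have "\<forall>\<omega>\<in>space M. \<exists>i<k. g \<omega> = y i"
      using val l less_le_trans by blast
    ultimately show ?thesis by blast
  next
    case True
    have "\<exists>i<l. emeasure M (A i) = \<infinity>"
    proof (rule ccontr)
      assume no: "\<not> ?thesis"
      have "(\<Union>i\<in>{..<l}. A i) \<in> fmeasurable M"
        by (rule fmeasurable.finite_UN) (use A no in \<open>auto simp: fmeasurable_def less_top\<close>)
      with un True show False by (auto simp: fmeasurable_def)
    qed
    then obtain i where i: "i < l" "emeasure M (A i) = \<infinity>" by blast
    have "y i = 0"
    proof (rule ccontr)
      assume "y i \<noteq> 0"
      then have pos: "0 < norm (y i) powr p" by simp
      have "ennreal (norm (y i) powr p) * emeasure M (A i)
          = (\<integral>\<^sup>+\<omega>. ennreal (norm (y i) powr p) * indicator (A i) \<omega> \<partial>M)"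
        using A i(1) by (simp add: nn_integral_cmult_indicator)
      also have "\<dots> \<le> (\<integral>\<^sup>+\<omega>. ennreal (norm (g \<omega>) powr p) \<partial>M)"
        by (rule nn_integral_mono) (use g_val[OF i(1)] in \<open>auto simp: indicator_def\<close>)
      also have "\<dots> < \<infinity>"
        using g by (simp add: G_functions_def Lp_functions_def)
      finally show False
        using pos i(2) by (simp add: ennreal_mult_top)
    qed
    then show ?thesis
    proof (intro exI[of _ "\<lambda>j. if j = 0 then y i else if j = i then y 0 else y j"] conjI ballI impI)
      fix \<omega> assume "\<omega> \<in> space M"
      then obtain j where j: "j < l" "g \<omega> = y j" using val by blast
      show "\<exists>j<k. g \<omega> = (if j = 0 then y i else if j = i then y 0 else y j)"
        by (rule exI[of _ "if j = 0 then i else if j = i then 0 else j"])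
           (use j i(1) l in auto)
    qed simp
  qed
qed

context quantization
begin

text \<open>
  Distances from the centres to a dense sequence in the range of \<open>f\<close> may be unbounded. The numbers
  \<open>1 / (1 + distance)\<close> lie in \<open>[0, 1]\<close>, so diagonal extraction applies to them, and a limit
  \<open>0\<close> means that the centre escapes to infinity. Not all centres can escape, by Fatou's lemma.
\<close>

lemma minimizing_sequence_subconverges:
  fixes g :: "nat \<Rightarrow> 'a \<Rightarrow> 'b"
  assumes uc: "uniformly_convex_norm TYPE('b)" and gd: "gateaux_differentiable_norm TYPE('b)"
    and g: "\<And>n. g n \<in> G_functions M p k"
    and cost: "(\<lambda>n. \<integral>\<omega>. norm (f \<omega> - g n \<omega>) powr p \<partial>M) \<longlonglongrightarrow> V"
  obtains h and \<sigma> :: "nat \<Rightarrow> nat" where "h \<in> G_functions M p k" "strict_mono \<sigma>"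
    "(\<lambda>n. \<integral>\<omega>. norm (g (\<sigma> n) \<omega> - h \<omega>) powr p \<partial>M) \<longlonglongrightarrow> 0"
proof -
  have gL: "g n \<in> Lp_functions M p" for n
    using g[of n] by (simp add: G_functions_def)
  have "\<forall>n. \<exists>c. (\<forall>\<omega>\<in>space M. \<exists>i<k. g n \<omega> = c i) \<and> (emeasure M (space M) = \<infinity> \<longrightarrow> c 0 = 0)"
    by (intro allI G_functions_centres[OF g space_nonempty])
  from choice[OF this] obtain X0 where X0: "\<And>n. \<forall>\<omega>\<in>space M. \<exists>i<k. g n \<omega> = X0 n i"
    "\<And>n. emeasure M (space M) = \<infinity> \<Longrightarrow> X0 n 0 = 0"
    by blast
  obtain \<omega>0 where \<omega>0: "\<omega>0 \<in> space M" using space_nonempty by blast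
  have k: "0 < k" using X0(1)[of 0] \<omega>0 by fastforce
  have "strongly_measurable M f" using f by (simp add: Lp_functions_def)
  then obtain y :: "nat \<Rightarrow> 'b" where y: "\<forall>\<omega>\<in>space M. \<forall>e>0. \<exists>q. norm (f \<omega> - y q) < e"
    by (rule strongly_measurable_separable)
  define a where "a n c = 1 / (1 + norm (y (fst c) - X0 n (snd c)))" for n and c :: "nat \<times> nat"
  have a01: "a n c \<in> {0..1}" for n c
  proof -
    have "1 / s \<in> {0..1}" if "1 \<le> s" for s :: real
      using that by simp
    then show ?thesis by (simp add: a_def del: atLeastAtMost_iff)
  qed
  obtain \<tau> :: "nat \<Rightarrow> nat" and l where \<tau>: "strict_mono \<tau>"
    and l: "\<And>c. (\<lambda>n. a (\<tau> n) c) \<longlonglongrightarrow> l c" "\<And>c. 0 \<le> l c"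
    by (rule convergent_subsequence_countable[of a, OF a01]) blast
  define X where "X n = X0 (\<tau> n)" for n
  have dist_a: "norm (y q - X n i) = 1 / a (\<tau> n) (q, i) - 1" for q n i
    by (simp add: a_def X_def)
  have a_pos: "0 < a n c" for n c
    by (simp add: a_def add_pos_nonneg)
  have y_lim: "(\<lambda>n. norm (y q - X n i)) \<longlonglongrightarrow> 1 / l (q, i) - 1" if "0 < l (q, i)" for q i
    unfolding dist_a using that by (intro tendsto_diff tendsto_divide tendsto_const l) auto
  \<comment> \<open>If the distance to one point \<open>y q\<close> has a finite limit, the centre stays bounded and so does its
    distance to every other one.\<close>
  define J where "J = {i. i < k \<and> (\<exists>q. 0 < l (q, i))}"
  have l_pos: "0 < l (q, i)" if i: "i \<in> J" for q i
  proof -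
    obtain q' where q': "0 < l (q', i)" using i by (auto simp: J_def)
    have "Bseq (\<lambda>n. norm (y q' - X n i))"
      by (rule convergent_imp_Bseq, rule convergentI, rule y_lim[OF q'])
    then obtain B where B: "0 < B" "\<And>n. norm (y q' - X n i) \<le> B"
      by (auto simp: Bseq_def)
    have "1 / (1 + (norm (y q - y q') + B)) \<le> a (\<tau> n) (q, i)" for n
    proof -
      have "norm (y q - X n i) \<le> norm (y q - y q') + norm (y q' - X n i)"
        using norm_triangle_ineq[of "y q - y q'" "y q' - X n i"] by simp
      then have "norm (y q - X n i) \<le> norm (y q - y q') + B" using B(2)[of n] by linarith
      then have "1 / (1 + (norm (y q - y q') + B)) \<le> 1 / (1 + norm (y q - X n i))"
        by (intro frac_le add_pos_nonneg) auto
      then show ?thesis by (simp add: a_def X_def)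
    qed
    then have "1 / (1 + (norm (y q - y q') + B)) \<le> l (q, i)"
      by (intro LIMSEQ_le_const[OF l(1)]) auto
    moreover have "0 < 1 / (1 + (norm (y q - y q') + B))"
      using B(1) by (simp add: add_pos_nonneg)
    ultimately show ?thesis by linarith
  qed
  define r where "r i \<omega> = Topological_Spaces.lim (\<lambda>n. norm (f \<omega> - X n i))" for i \<omega>
  have lim: "(\<lambda>n. norm (f \<omega> - X n i)) \<longlonglongrightarrow> r i \<omega>" if i: "i \<in> J" and \<omega>: "\<omega> \<in> space M" for i \<omega>
  proof -
    have "Cauchy (\<lambda>n. norm (f \<omega> - X n i))"
    proof (rule CauchyI)
      fix e :: real assume "0 < e"
      then obtain q where q: "norm (f \<omega> - y q) < e / 3" using y \<omega> by (meson divide_pos_pos zero_less_numeral)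
      have "Cauchy (\<lambda>n. norm (y q - X n i))"
        by (rule LIMSEQ_imp_Cauchy[OF y_lim[OF l_pos[OF i]]])
      from CauchyD[OF this, of "e / 3"] obtain N
        where N: "\<And>n n'. N \<le> n \<Longrightarrow> N \<le> n' \<Longrightarrow> \<bar>norm (y q - X n i) - norm (y q - X n' i)\<bar> < e / 3"
        using \<open>0 < e\<close> by auto
      have near: "\<bar>norm (f \<omega> - X n i) - norm (y q - X n i)\<bar> < e / 3" for n
        using norm_triangle_ineq3[of "f \<omega> - X n i" "y q - X n i"] q by simp
      have "norm (norm (f \<omega> - X n i) - norm (f \<omega> - X n' i)) < e" if "N \<le> n" "N \<le> n'" for n n'
        using N[OF that] near[of n] near[of n'] unfolding real_norm_def by linarith
      then show "\<exists>N. \<forall>n\<ge>N. \<forall>n'\<ge>N. norm (norm (f \<omega> - X n i) - norm (f \<omega> - X n' i)) < e"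
        by blast
    qed
    then show ?thesis
      by (simp add: r_def Cauchy_convergent_iff convergent_LIMSEQ_iff)
  qed
  have far: "filterlim (\<lambda>n. norm (X n i)) at_top sequentially" if i: "i < k" "i \<notin> J" for i
  proof -
    have "\<not> 0 < l (0, i)" using i by (auto simp: J_def)
    then have "l (0, i) = 0" using l(2)[of "(0, i)"] by linarith
    then have "filterlim (\<lambda>n. inverse (a (\<tau> n) (0, i))) at_top sequentially"
      using l(1)[of "(0, i)"] by (intro filterlim_inverse_at_top) (simp_all add: a_pos)
    then have "filterlim (\<lambda>n. - (1 + norm (y 0)) + inverse (a (\<tau> n) (0, i))) at_top sequentially"
      by (rule filterlim_tendsto_add_at_top[OF tendsto_const])
    then show ?thesis
    proof (rule filterlim_at_top_mono)
      show "\<forall>\<^sub>F n in sequentially. - (1 + norm (y 0)) + inverse (a (\<tau> n) (0, i)) \<le> norm (X n i)"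
      proof (intro always_eventually allI)
        fix n
        have "norm (y 0 - X n i) \<le> norm (y 0) + norm (X n i)" by (rule norm_triangle_ineq4)
        then show "- (1 + norm (y 0)) + inverse (a (\<tau> n) (0, i)) \<le> norm (X n i)"
          using dist_a[of 0 n i] by (simp add: inverse_eq_divide)
      qed
    qed
  qed
  have zero: "X n 0 = 0" if "emeasure M (space M) = \<infinity>" for n
    using X0(2)[OF that] by (simp add: X_def)
  have zero_J: "0 \<in> J" if inf: "emeasure M (space M) = \<infinity>"
  proof (rule ccontr)
    assume "0 \<notin> J"
    from far[OF k this] have "filterlim (\<lambda>n::nat. 0::real) at_top sequentially"
      using zero[OF inf] by simp
    then show False
      by (auto simp: filterlim_at_top_dense dest: spec[of _ 0])
  qed
  define g' where "g' n = g (\<tau> n)" for n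
  have g'_val: "\<exists>i<k. g' n \<omega> = X n i" if "\<omega> \<in> space M" for n \<omega>
    using X0(1) that by (simp add: g'_def X_def)
  have cost': "(\<lambda>n. \<integral>\<omega>. norm (f \<omega> - g' n \<omega>) powr p \<partial>M) \<longlonglongrightarrow> V"
    unfolding g'_def by (rule filterlim_compose[OF cost filterlim_subseq[OF \<tau>]])
  have J_ne: "J \<noteq> {}"
  proof
    assume none: "J = {}"
    define v where "v n \<omega> = norm (f \<omega> - g' n \<omega>) powr p" for n \<omega>
    have iv: "integrable M (v n)" for n
      unfolding v_def[abs_def] g'_def using p
      by (intro Lp_functions_integrable Lp_functions_diff f gL) simp
    have v_top: "filterlim (\<lambda>n. v n \<omega>) at_top sequentially" if \<omega>: "\<omega> \<in> space M" for \<omega>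
      unfolding filterlim_at_top
    proof
      fix Z :: real
      have "\<forall>\<^sub>F n in sequentially. \<forall>i\<in>{..<k}. norm (X n i) > norm (f \<omega>) + max Z 1"
        by (rule eventually_ball_finite) (use far none in \<open>auto simp: filterlim_at_top_dense\<close>)
      then show "\<forall>\<^sub>F n in sequentially. Z \<le> v n \<omega>"
      proof eventually_elim
        case (elim n)
        obtain i where i: "i < k" "g' n \<omega> = X n i" using g'_val[OF \<omega>] by blast
        have "norm (X n i) \<le> norm (f \<omega>) + norm (f \<omega> - X n i)"
          using norm_triangle_sub[of "X n i" "f \<omega>"] by (simp add: norm_minus_commute)
        moreover have "norm (f \<omega>) + max Z 1 < norm (X n i)" using elim i(1) by simp
        ultimately have big: "max Z 1 \<le> norm (f \<omega> - g' n \<omega>)" unfolding i(2) by linarith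
        then have "norm (f \<omega> - g' n \<omega>) powr 1 \<le> norm (f \<omega> - g' n \<omega>) powr p"
          using p by (intro powr_mono) auto
        with big show ?case by (simp add: v_def)
      qed
    qed
    have "(\<integral>\<^sup>+\<omega>. top \<partial>M) = (\<integral>\<^sup>+\<omega>. liminf (\<lambda>n. ennreal (v n \<omega>)) \<partial>M)"
    proof (rule nn_integral_cong)
      fix \<omega> assume "\<omega> \<in> space M"
      then have "(\<lambda>n. ennreal (v n \<omega>)) \<longlonglongrightarrow> top"
        unfolding ennreal_tendsto_top_eq_at_top by (rule v_top)
      then show "top = liminf (\<lambda>n. ennreal (v n \<omega>))"
        by (simp add: lim_imp_Liminf)
    qed
    also have "\<dots> \<le> liminf (\<lambda>n. \<integral>\<^sup>+\<omega>. ennreal (v n \<omega>) \<partial>M)"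
      by (rule nn_integral_liminf) (use borel_measurable_integrable[OF iv] in measurable)
    also have "\<dots> = liminf (\<lambda>n. ennreal (\<integral>\<omega>. v n \<omega> \<partial>M))"
    proof -
      have "(\<integral>\<^sup>+\<omega>. ennreal (v n \<omega>) \<partial>M) = ennreal (\<integral>\<omega>. v n \<omega> \<partial>M)" for n
        by (rule nn_integral_eq_integral[OF iv]) (simp add: v_def)
      then show ?thesis by simp
    qed
    also have "\<dots> = ennreal V"
      using cost' by (intro lim_imp_Liminf) (simp_all add: v_def)
    finally show False
      using nonnull by (simp add: ennreal_top_mult top_unique split: if_splits)
  qed
  interpret minimizing_centres M p k f V X J r g'
  proof
    show "J \<subseteq> {..<k}" by (auto simp: J_def)
    show "g' n \<in> Lp_functions M p" for n by (simp add: g'_def gL)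
  qed (fact uc gd J_ne zero_J zero lim far g'_val cost')+
  obtain h and \<sigma> :: "nat \<Rightarrow> nat" where "h \<in> G_functions M p k" "strict_mono \<sigma>"
    "(\<lambda>n. \<integral>\<omega>. norm (g' (\<sigma> n) \<omega> - h \<omega>) powr p \<partial>M) \<longlonglongrightarrow> 0"
    by (rule subsequence_converges)
  then show thesis
    using strict_mono_o[OF \<tau>, of \<sigma>] by (intro that[of h "\<tau> \<circ> \<sigma>"]) (auto simp: g'_def)
qed

end

lemma has_convergent_subnet_subsequence:
  assumes "strict_mono \<sigma>" "(\<lambda>n. d (w (\<sigma> n)) y) \<longlonglongrightarrow> 0"
  shows "has_convergent_subnet d w y"
proof (rule subnet_index_universal)
  show "subnet_index (UNIV :: nat set) (\<le>) \<sigma>"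
    unfolding subnet_index_def directed_set_def
    using strict_mono_imp_increasing[OF assms(1)] by (auto intro: le_trans max.cobounded1 max.cobounded2)
  show "net_converges d (UNIV :: nat set) (\<le>) (\<lambda>i. w (\<sigma> i)) y"
    unfolding net_converges_def
  proof (intro allI impI)
    fix e :: real assume "0 < e"
    then have "\<forall>\<^sub>F n in sequentially. d (w (\<sigma> n)) y < e"
      by (rule order_tendstoD(2)[OF assms(2)])
    then show "\<exists>i0\<in>UNIV. \<forall>i\<in>UNIV. i0 \<le> i \<longrightarrow> d (w (\<sigma> i)) y < e"
      by (simp add: eventually_sequentially)
  qed
qed

lemma Lp_dist_eq_integral:
  assumes "f \<in> Lp_functions M p" "g \<in> Lp_functions M p" "0 \<le> p"
  shows "Lp_dist M p (Lp_class M p f) (Lp_class M p g) = (\<integral>\<omega>. norm (f \<omega> - g \<omega>) powr p \<partial>M) powr (1 / p)"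
  using assms by (simp add: Lp_dist_class Lp_norm_eq_integral Lp_functions_diff)

theorem corollary1p3:
  fixes M :: "'a measure" and p :: real and k :: nat
  assumes "1 < p"
    and "1 \<le> k"
    and "uniformly_convex_norm TYPE('b::banach)"
    and "gateaux_differentiable_norm TYPE('b)"
  shows "approximatively_norm_compact
           (Lp_space M p :: ('a \<Rightarrow> 'b) set set) (Lp_dist M p) (G_set M p k)"
  unfolding approximatively_norm_compact_def
proof (intro ballI allI impI)
  fix z and w :: "nat \<Rightarrow> ('a \<Rightarrow> 'b) set"
  assume z: "z \<in> Lp_space M p" and w: "minimizing_sequence (Lp_dist M p) (G_set M p k) z w"
  obtain f where fL: "f \<in> Lp_functions M p" and z_eq: "z = Lp_class M p f"
    using z unfolding Lp_space_def by (rule quotientE)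
  have "\<forall>n. \<exists>g. g \<in> G_functions M p k \<and> w n = Lp_class M p g"
    using w by (auto simp: minimizing_sequence_def G_set_def)
  from choice[OF this] obtain g where g: "\<And>n. g n \<in> G_functions M p k" and w_eq: "\<And>n. w n = Lp_class M p (g n)"
    by blast
  have GL: "h \<in> Lp_functions M p" if "h \<in> G_functions M p k" for h :: "'a \<Rightarrow> 'b"
    using that by (simp add: G_functions_def)
  have int_nonneg: "0 \<le> (\<integral>\<omega>. norm (u \<omega> - v \<omega>) powr p \<partial>M)" for u v :: "'a \<Rightarrow> 'b"
    by (rule integral_nonneg_AE) simp
  have dist: "Lp_dist M p (Lp_class M p u) (Lp_class M p v) powr p = (\<integral>\<omega>. norm (u \<omega> - v \<omega>) powr p \<partial>M)"
    if "u \<in> Lp_functions M p" "v \<in> Lp_functions M p" for u v :: "'a \<Rightarrow> 'b"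
    using Lp_dist_eq_integral[OF that] assms(1) int_nonneg[of u v] by (simp add: powr_powr)
  show "\<exists>y\<in>G_set M p k. has_convergent_subnet (Lp_dist M p) w y"
  proof (cases "emeasure M (space M) = 0")
    case True
    have "AE \<omega> in M. P \<omega>" for P
      by (rule AE_I'[of "space M"]) (use True in auto)
    then have "(\<integral>\<omega>. norm (u \<omega> - v \<omega>) powr p \<partial>M) = 0" for u v :: "'a \<Rightarrow> 'b"
      by (intro integral_eq_zero_AE)
    then have "Lp_dist M p (w n) (w 0) = 0" for n
      unfolding w_eq using Lp_dist_eq_integral[OF GL[OF g] GL[OF g]] assms(1) by simp
    then have "has_convergent_subnet (Lp_dist M p) w (w 0)"
      by (intro has_convergent_subnet_subsequence[of id]) (auto simp: strict_mono_def)
    then show ?thesis using w by (auto simp: minimizing_sequence_def)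
  next
    case False
    define d where "d = (INF v\<in>G_set M p k. Lp_dist M p z v)"
    have dist_nonneg: "0 \<le> Lp_dist M p u v" for u v :: "('a \<Rightarrow> 'b) set"
      by (simp add: Lp_dist_def Lp_norm_def)
    have ne: "G_set M p k \<noteq> ({} :: ('a \<Rightarrow> 'b) set set)"
      using w by (auto simp: minimizing_sequence_def)
    have d0: "0 \<le> d"
      unfolding d_def by (rule cINF_greatest[OF ne]) (rule dist_nonneg)
    have d_le: "d powr p \<le> (\<integral>\<omega>. norm (f \<omega> - h \<omega>) powr p \<partial>M)" if h: "h \<in> G_functions M p k" for h
    proof -
      have "d \<le> Lp_dist M p z (Lp_class M p h)"
        unfolding d_def
        by (rule cINF_lower) (use h dist_nonneg in \<open>auto simp: G_set_def intro!: bdd_belowI2\<close>)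
      then have "d powr p \<le> Lp_dist M p z (Lp_class M p h) powr p"
        using d0 assms(1) by (intro powr_mono2) auto
      then show ?thesis using dist[OF fL GL[OF h]] z_eq by simp
    qed
    interpret quantization M p k f "d powr p"
      by standard (use assms(1) fL False d_le in auto)
    have "(\<lambda>n. Lp_dist M p z (w n)) \<longlonglongrightarrow> d"
      using w by (simp add: minimizing_sequence_def d_def)
    then have "(\<lambda>n. Lp_dist M p z (w n) powr p) \<longlonglongrightarrow> d powr p"
      by (rule tendsto_powr2[OF _ tendsto_const]) (use assms(1) dist_nonneg in auto)
    then have "(\<lambda>n. \<integral>\<omega>. norm (f \<omega> - g n \<omega>) powr p \<partial>M) \<longlonglongrightarrow> d powr p"
      using dist[OF fL GL[OF g]] by (simp add: w_eq z_eq)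
    then obtain h and \<sigma> :: "nat \<Rightarrow> nat" where h: "h \<in> G_functions M p k" "strict_mono \<sigma>"
      and lim: "(\<lambda>n. \<integral>\<omega>. norm (g (\<sigma> n) \<omega> - h \<omega>) powr p \<partial>M) \<longlonglongrightarrow> 0"
      by (rule minimizing_sequence_subconverges[OF assms(3,4) g])
    have "(\<lambda>n. Lp_dist M p (w (\<sigma> n)) (Lp_class M p h)) \<longlonglongrightarrow> 0"
    proof -
      have "(\<lambda>n. (\<integral>\<omega>. norm (g (\<sigma> n) \<omega> - h \<omega>) powr p \<partial>M) powr (1 / p)) \<longlonglongrightarrow> 0 powr (1 / p)"
        by (rule tendsto_powr2[OF lim tendsto_const]) (use assms(1) int_nonneg in auto)
      then show ?thesis
        using Lp_dist_eq_integral[OF GL[OF g] GL[OF h(1)]] assms(1) by (simp add: w_eq)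
    qed
    with h(2) have "has_convergent_subnet (Lp_dist M p) w (Lp_class M p h)"
      by (rule has_convergent_subnet_subsequence)
    then show ?thesis
      using h(1) by (auto simp: G_set_def)
  qed
qed

end
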